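(* Let $H$ be a unimodular hypergraph on the vertex set $\{1,\ldots,n\}$ with cover ideal $J(H)\subseteq S=\mathbf{k}[x_1,\ldots,x_n]$. For every edge $F$ of $H$, with corresponding prime ideal $P=(x_j\mid j\in F)$ of $S$, there exists an integer constant $\gamma_P$ such that for all integers $t\ge 1$, \[ v_P\bigl(J(H)^t\bigr)=v_P\bigl(J(H)\bigr)+(t-1)\gamma_P . \] Consequently, $v\bigl(J(H)^t\bigr)$ is a linear function of $t$ for all integers $t\ge 1$ with $t\ge n-1$; that is, there are integers $a,b$ such that $v(J(H)^t)=at+b$ for all such $t$.
   Context: A hypergraph $H=(V,E)$ consists of a finite vertex set $V=\{1,\ldots,n\}$ and a collection $E=\{F_1,\ldots,F_m\}$ of nonempty subsets of $V$, called edges, such that no edge contains another; $H$ is assumed to have at least one edge. $H$ is unimodular if its edge-vertex incidence matrix (the $m\times n$ matrix with $(i,j)$ entry $1$ if $j\in F_i$ and $0$ otherwise) is totally unimodular, i.e. every square submatrix has determinant $0$, $1$ or $-1$. $S=\mathbf{k}[x_1,\ldots,x_n]$ is the standard graded polynomial ring over a field $\mathbf{k}$, and $S_d$ is its degree-$d$ homogeneous component. The cover ideal of $H$ is $J(H)=\bigcap_{i=1}^m (x_j\mid j\in F_i)$. For a nonzero homogeneous ideal $I$ of $S$ with set of associated primes $\operatorname{Ass}(I)$, and $P\in\operatorname{Ass}(I)$, the local $v$-number is $v_P(I)=\min\{d\ge 0\mid \text{there exists } f\in S_d \text{ with } I:f=P\}$. The (global) $v$-number is $v(I)=\min_{P\in\operatorname{Ass}(I)}v_P(I)$.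 *)

theory Defs
  imports
    "HOL-Library.Poly_Mapping"
    "HOL-Algebra.Ideal_Product"
    "Jordan_Normal_Form.Determinant"
    "Jordan_Normal_Form.DL_Submatrix"
begin

section \<open>Unimodular hypergraphs\<close>

text \<open>A hypergraph on the vertex set \<open>{1..n}\<close> is given by the list \<open>[F\<^sub>1, ..., F\<^sub>m]\<close> of its edges.
  The antichain condition is imposed on positions, so it also makes the list distinct.\<close>

definition hypergraph :: "nat \<Rightarrow> nat set list \<Rightarrow> bool" where
  "hypergraph n Fs \<longleftrightarrow>
     Fs \<noteq> [] \<and>
     (\<forall>F\<in>set Fs. F \<noteq> {} \<and> F \<subseteq> {1..n}) \<and>
     (\<forall>i<length Fs. \<forall>j<length Fs. i \<noteq> j \<longrightarrow> \<not> Fs ! i \<subseteq> Fs ! j)"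

text \<open>Matrix indices start at 0, so column \<open>j\<close> belongs to the vertex \<open>j + 1\<close>.\<close>

definition incidence_mat :: "nat \<Rightarrow> nat set list \<Rightarrow> int mat" where
  "incidence_mat n Fs =
     mat (length Fs) n (\<lambda>(i, j). if j + 1 \<in> Fs ! i then 1 else 0)"

definition totally_unimodular :: "int mat \<Rightarrow> bool" where
  "totally_unimodular A \<longleftrightarrow>
     (\<forall>I J. square_mat (submatrix A I J) \<longrightarrow> det (submatrix A I J) \<in> {0, 1, -1})"

definition unimodular_hypergraph :: "nat \<Rightarrow> nat set list \<Rightarrow> bool" where
  "unimodular_hypergraph n Fs \<longleftrightarrow>
     hypergraph n Fs \<and> totally_unimodular (incidence_mat n Fs)"


section \<open>The polynomial ring in the variables \<open>x\<^sub>1, ..., x\<^sub>n\<close>\<close>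

text \<open>A polynomial is a finitely supported map from exponent vectors to coefficients. The type
  has a variable for every natural number; the carrier below keeps only \<open>x\<^sub>1, ..., x\<^sub>n\<close>.\<close>

type_synonym 'k mpoly = "(nat \<Rightarrow>\<^sub>0 nat) \<Rightarrow>\<^sub>0 'k"

definition poly_ring :: "nat \<Rightarrow> 'k::field mpoly ring" where
  "poly_ring n =
     \<lparr>carrier = {p. \<forall>m\<in>Poly_Mapping.keys p. Poly_Mapping.keys m \<subseteq> {1..n}},
      monoid.mult = (*), one = 1, zero = 0, add = (+)\<rparr>"

lemma cring_poly_ring: "cring (poly_ring n :: 'k::field mpoly ring)"
proof (rule cringI)
  show "abelian_group (poly_ring n :: 'k mpoly ring)"
  proof (rule abelian_groupI)
    fix p :: "'k mpoly" assume "p \<in> carrier (poly_ring n)"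
    then have "- p \<in> carrier (poly_ring n)"
      by (simp add: poly_ring_def)
    then show "\<exists>q\<in>carrier (poly_ring n). q \<oplus>\<^bsub>poly_ring n\<^esub> p = \<zero>\<^bsub>poly_ring n\<^esub>"
      by (intro bexI[of _ "- p"]) (simp_all add: poly_ring_def)
  next
    fix p q :: "'k mpoly"
    assume "p \<in> carrier (poly_ring n)" "q \<in> carrier (poly_ring n)"
    then show "p \<oplus>\<^bsub>poly_ring n\<^esub> q \<in> carrier (poly_ring n)"
      using Poly_Mapping.keys_add[of p q] unfolding poly_ring_def by auto
  qed (auto simp: poly_ring_def algebra_simps)
  show "comm_monoid (poly_ring n :: 'k mpoly ring)"
  proof (rule comm_monoidI)
    fix p q :: "'k mpoly"
    assume pq: "p \<in> carrier (poly_ring n)" "q \<in> carrier (poly_ring n)"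
    have "Poly_Mapping.keys m \<subseteq> {1..n}" if m: "m \<in> Poly_Mapping.keys (p * q)" for m
    proof -
      obtain a b where ab: "m = a + b" "a \<in> Poly_Mapping.keys p" "b \<in> Poly_Mapping.keys q"
        using keys_mult[of p q] m by blast
      then show ?thesis
        using pq Poly_Mapping.keys_add[of a b] unfolding poly_ring_def by fastforce
    qed
    then show "p \<otimes>\<^bsub>poly_ring n\<^esub> q \<in> carrier (poly_ring n)"
      by (simp add: poly_ring_def)
  qed (auto simp: poly_ring_def algebra_simps)
qed (auto simp: poly_ring_def algebra_simps)

definition var :: "nat \<Rightarrow> 'k::field mpoly" where
  "var j = Poly_Mapping.single (Poly_Mapping.single j 1) 1"

definition homogeneous_component :: "nat \<Rightarrow> nat \<Rightarrow> 'k::field mpoly set" where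
  "homogeneous_component n d =
     {p \<in> carrier (poly_ring n).
        \<forall>m\<in>Poly_Mapping.keys p. (\<Sum>j\<in>Poly_Mapping.keys m. Poly_Mapping.lookup m j) = d}"

definition var_ideal :: "nat \<Rightarrow> nat set \<Rightarrow> 'k::field mpoly set" where
  "var_ideal n F = Idl\<^bsub>poly_ring n\<^esub> (var ` F)"

definition cover_ideal :: "nat \<Rightarrow> nat set list \<Rightarrow> 'k::field mpoly set" where
  "cover_ideal n Fs = (\<Inter>F\<in>set Fs. var_ideal n F)"


section \<open>Associated primes and v-numbers\<close>

definition colon :: "('a, 'b) ring_scheme \<Rightarrow> 'a set \<Rightarrow> 'a \<Rightarrow> 'a set" where
  "colon R I f = {g \<in> carrier R. g \<otimes>\<^bsub>R\<^esub> f \<in> I}"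

definition associated_primes :: "('a, 'b) ring_scheme \<Rightarrow> 'a set \<Rightarrow> 'a set set" where
  "associated_primes R I = {P. primeideal P R \<and> (\<exists>f\<in>carrier R. colon R I f = P)}"

text \<open>The local v-number is meaningful for homogeneous \<open>I\<close> and \<open>P \<in> associated_primes (poly_ring n) I\<close>
  only; then the minimum is over a nonempty set.\<close>

definition local_v_number :: "nat \<Rightarrow> 'k::field mpoly set \<Rightarrow> 'k mpoly set \<Rightarrow> nat" where
  "local_v_number n I P = (LEAST d. \<exists>f\<in>homogeneous_component n d. colon (poly_ring n) I f = P)"

text \<open>An infimum of a nonempty set of natural numbers is attained, so this is a minimum.\<close>

definition v_number :: "nat \<Rightarrow> 'k::field mpoly set \<Rightarrow> nat" where
  "v_number n I = (INF P\<in>associated_primes (poly_ring n) I. local_v_number n I P)"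

definition ideal_power :: "nat \<Rightarrow> 'k::field mpoly set \<Rightarrow> nat \<Rightarrow> 'k mpoly set" where
  "ideal_power n I t = I [^]\<^bsub>ideals_set (poly_ring n)\<^esub> t"

end

theory Submission
  imports Defs
begin

text \<open>Write \<open>wt F m\<close> for the total exponent of a monomial \<open>m\<close> in the variables of \<open>F\<close>. The argument
  rests on a rounding property of a totally unimodular matrix \<open>A\<close>: for every integer vector \<open>w\<close> and
  every \<open>k \<ge> 1\<close> there is an integer vector \<open>z\<close> such that each coordinate of \<open>z\<close> and of \<open>A z\<close> is the
  corresponding coordinate of \<open>w / k\<close> or of \<open>A w / k\<close>, rounded up or down
  (\<open>totally_unimodular_rounding\<close>). For a unimodular hypergraph it follows that every monomial can
  be cut into \<open>k\<close> parts on which the values \<open>wt F\<close> are distributed as evenly as possible, one part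
  at a time (\<open>unimodular_split\<close>).

  The first consequence is that \<open>J\<^sup>t\<close> is spanned by the monomials \<open>m\<close> with \<open>wt F m \<ge> t\<close> for all edges
  \<open>F\<close>, so ordinary and symbolic powers agree (\<open>ideal_power_cover_ideal\<close>). Because no edge contains
  another, the prime of \<open>F\<close> is \<open>J\<^sup>t : f\<close> for some homogeneous \<open>f\<close> of degree \<open>d\<close> if and only if it is
  \<open>J\<^sup>t : a\<close> for some monomial \<open>a\<close> of degree \<open>d\<close>, and the latter equality means \<open>wt F a = t - 1\<close> and
  \<open>wt G a \<ge> t\<close> for all other edges \<open>G\<close> (\<open>local_v_number_eq_Least\<close>).

  The second consequence is the linearity. Such an \<open>a\<close> can be cut into \<open>t\<close> parts that have \<open>wt\<close> at
  least \<open>1\<close> on every edge other than \<open>F\<close> and at most \<open>1\<close> on \<open>F\<close>. Exactly one part has \<open>wt\<close> equal to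
  \<open>0\<close> on \<open>F\<close>; it is a monomial of the same kind for \<open>t = 1\<close>. The other \<open>t - 1\<close> parts have \<open>wt\<close> equal
  to \<open>1\<close> on \<open>F\<close>. Conversely, products of such parts are monomials of the required kind. Hence the
  local v-number is \<open>\<alpha>\<^sub>F + (t - 1) \<gamma>\<^sub>F\<close>, where \<open>\<alpha>\<^sub>F\<close> and \<open>\<gamma>\<^sub>F\<close> are the least degrees of parts of
  the two kinds (\<open>local_v_number_linear\<close>).

  Finally, the associated primes of \<open>J\<^sup>t\<close> are the primes of the edges
  (\<open>associated_primes_cover_power\<close>), so the v-number is a minimum of finitely many linear functions
  of \<open>t\<close>. Always \<open>\<alpha>\<^sub>F \<le> n - 1\<close>, and \<open>\<alpha>\<^sub>F \<ge> 1\<close> if there is a second edge. Among the functions of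
  least slope, one with the least \<open>\<alpha>\<^sub>F\<close> is therefore minimal as soon as \<open>t - 1 \<ge> n - 2\<close>.\<close>

section \<open>Rounding integer vectors with a totally unimodular matrix\<close>

text \<open>The square matrix cut out of \<open>A\<close> by a list of row indices and a list of column indices of
  the same length, in the listed order. Lists rather than sets of indices make it possible to
  append a row and a column at the end.\<close>

definition list_minor :: "'a mat \<Rightarrow> nat list \<Rightarrow> nat list \<Rightarrow> 'a mat" where
  "list_minor A rs cs = mat (length rs) (length rs) (\<lambda>(a, b). A $$ (rs ! a, cs ! b))"

lemma list_minor_carrier [simp]: "list_minor A rs cs \<in> carrier_mat (length rs) (length rs)"
  by (simp add: list_minor_def)

lemma distinct_list_pick_permutation:
  assumes "distinct xs"
  obtains p where "p permutes {0..<length xs}"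
    "\<And>a. a < length xs \<Longrightarrow> xs ! a = pick (set xs) (p a)"
proof -
  define q where "q a = card {x \<in> set xs. x < xs ! a}" for a
  have q: "pick (set xs) (q a) = xs ! a" if "a < length xs" for a
    unfolding q_def using that by (intro pick_card_in_set) auto
  have lt: "q a < length xs" if a: "a < length xs" for a
  proof -
    have "xs ! a \<in> set xs" "xs ! a \<notin> {x \<in> set xs. x < xs ! a}" using a by simp_all
    then have "{x \<in> set xs. x < xs ! a} \<subset> set xs" by blast
    then have "q a < card (set xs)" unfolding q_def by (intro psubset_card_mono) auto
    then show ?thesis using assms by (simp add: distinct_card)
  qed
  define p where "p a = (if a < length xs then q a else a)" for a
  have inj: "inj_on p {0..<length xs}"
  proof (rule inj_onI)
    fix a b assume *: "a \<in> {0..<length xs}" "b \<in> {0..<length xs}" "p a = p b"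
    then have "xs ! a = xs ! b" using q[of a] q[of b] by (simp add: p_def)
    then show "a = b" using * assms by (simp add: nth_eq_iff_index_eq)
  qed
  have sub: "p ` {0..<length xs} \<subseteq> {0..<length xs}" using lt by (auto simp: p_def)
  have "bij_betw p {0..<length xs} {0..<length xs}"
    using inj sub by (simp add: bij_betw_def endo_inj_surj)
  then have "p permutes {0..<length xs}"
    by (rule bij_imp_permutes) (simp add: p_def)
  then show thesis using that q by (simp add: p_def)
qed

text \<open>A repeated index makes the determinant vanish; otherwise sorting the two lists changes only its
  sign and gives a submatrix.\<close>

lemma det_list_minor:
  fixes A :: "int mat"
  assumes tu: "totally_unimodular A"
    and len: "length rs = length cs"
    and rs: "set rs \<subseteq> {..<dim_row A}" and cs: "set cs \<subseteq> {..<dim_col A}"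
  shows "det (list_minor A rs cs) \<in> {0, 1, -1}"
proof (cases "distinct rs \<and> distinct cs")
  case False
  let ?k = "length rs" and ?M = "list_minor A rs cs"
  from False have "\<not> distinct rs \<or> \<not> distinct cs" by simp
  then have "det ?M = 0"
  proof
    assume "\<not> distinct rs"
    then obtain i j where ij: "i < ?k" "j < ?k" "i \<noteq> j" "rs ! i = rs ! j"
      by (auto simp: distinct_conv_nth)
    then have "row ?M i = row ?M j" by (auto simp: list_minor_def)
    then show ?thesis using ij det_identical_rows[OF list_minor_carrier] by blast
  next
    assume "\<not> (distinct cs)"
    then obtain i j where ij: "i < ?k" "j < ?k" "i \<noteq> j" "cs ! i = cs ! j"
      using len by (auto simp: distinct_conv_nth)
    then have "col ?M i = col ?M j" by (auto simp: list_minor_def)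
    then show ?thesis using ij det_identical_columns[OF list_minor_carrier] by blast
  qed
  then show ?thesis by simp
next
  case True
  let ?k = "length rs" and ?I = "set rs" and ?J = "set cs"
  let ?S = "submatrix A ?I ?J"
  obtain p where p: "p permutes {0..<?k}" "\<And>a. a < ?k \<Longrightarrow> rs ! a = pick ?I (p a)"
    using distinct_list_pick_permutation True by blast
  obtain q where q: "q permutes {0..<?k}" "\<And>a. a < ?k \<Longrightarrow> cs ! a = pick ?J (q a)"
    using distinct_list_pick_permutation[of cs] True len by auto
  have "{i. i < dim_row A \<and> i \<in> ?I} = ?I" "{j. j < dim_col A \<and> j \<in> ?J} = ?J"
    using rs cs by auto
  then have S: "?S = mat ?k ?k (\<lambda>(i, j). A $$ (pick ?I i, pick ?J j))"
    using True len by (simp add: submatrix_def distinct_card)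
  then have Sc: "?S \<in> carrier_mat ?k ?k" by simp
  have pl: "p a < ?k" "q a < ?k" if "a < ?k" for a
    using p(1) q(1) that permutes_in_image[of p "{0..<?k}" a] permutes_in_image[of q "{0..<?k}" a]
    by auto
  define T where "T = mat ?k ?k (\<lambda>(i, j). ?S $$ (p i, j))"
  have Tc: "T \<in> carrier_mat ?k ?k" by (simp add: T_def)
  have "transpose_mat (list_minor A rs cs) = mat ?k ?k (\<lambda>(i, j). transpose_mat T $$ (q i, j))"
    by (rule eq_matI) (auto simp: list_minor_def T_def S p(2) q(2) pl)
  then have "det (list_minor A rs cs) = signof q * det T"
    using det_permute_rows[OF _ q(1), of "transpose_mat T"] Tc
      det_transpose[OF Tc] det_transpose[OF list_minor_carrier[of A rs cs]] by simp
  also have "det T = signof p * det ?S"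
    unfolding T_def by (rule det_permute_rows[OF Sc p(1)])
  finally have "det (list_minor A rs cs) = signof q * (signof p * det ?S)" .
  moreover have "det ?S \<in> {0, 1, -1}"
    using tu Sc unfolding totally_unimodular_def by (metis carrier_matD square_mat.simps)
  ultimately show ?thesis by (auto simp: sign_def split: if_splits)
qed

text \<open>A nonsingular minor with rows in \<open>R\<close> and columns in \<open>C\<close> of maximal size. The size is bounded since
  the columns of a nonsingular minor are distinct, and the empty minor has determinant \<open>1\<close>.\<close>

lemma maximal_nonsingular_minor:
  fixes A :: "int mat"
  assumes C: "finite C"
  obtains rs cs where "length rs = length cs" "set rs \<subseteq> R" "set cs \<subseteq> C" "distinct cs"
    "det (list_minor A rs cs) \<noteq> 0"
    "\<And>i c. i \<in> R \<Longrightarrow> c \<in> C \<Longrightarrow> det (list_minor A (rs @ [i]) (cs @ [c])) = 0"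
proof -
  define P where "P k \<longleftrightarrow> (\<exists>rs cs. length rs = k \<and> length cs = k \<and> set rs \<subseteq> R \<and> set cs \<subseteq> C \<and>
      det (list_minor A rs cs) \<noteq> 0)" for k
  have dist: "distinct cs" if len: "length rs = length cs" and det: "det (list_minor A rs cs) \<noteq> 0" for rs cs
  proof (rule ccontr)
    assume "\<not> (distinct cs)"
    then obtain i j where ij: "i < length rs" "j < length rs" "i \<noteq> j" "cs ! i = cs ! j"
      using len by (auto simp: distinct_conv_nth)
    then have "col (list_minor A rs cs) i = col (list_minor A rs cs) j" by (auto simp: list_minor_def)
    then show False using ij det_identical_columns[OF list_minor_carrier] det by blast
  qed
  have P0: "P 0" by (auto simp: P_def list_minor_def)
  have bound: "k \<le> card C" if "P k" for k
  proof -
    from that obtain rs cs where *: "length rs = k" "length cs = k" "set cs \<subseteq> C"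
      "det (list_minor A rs cs) \<noteq> 0" unfolding P_def by blast
    then have "card (set cs) = k" using dist by (simp add: distinct_card)
    then show ?thesis using * card_mono[OF C] by metis
  qed
  define k where "k = (GREATEST k. P k)"
  have "P k" unfolding k_def using P0 bound by (rule GreatestI_nat)
  moreover have "\<not> P (Suc k)"
    using Greatest_le_nat[of P "Suc k" "card C"] bound unfolding k_def by fastforce
  ultimately obtain rs cs where *: "length rs = k" "length cs = k" "set rs \<subseteq> R" "set cs \<subseteq> C"
     "det (list_minor A rs cs) \<noteq> 0" unfolding P_def by blast
  have "det (list_minor A (rs @ [i]) (cs @ [c])) = 0" if "i \<in> R" "c \<in> C" for i c
  proof (rule ccontr)
    assume "\<not> ?thesis"
    then have "P (Suc k)" unfolding P_def
      using * that by (intro exI[of _ "rs @ [i]"] exI[of _ "cs @ [c]"]) auto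
    then show False using \<open>\<not> P (Suc k)\<close> by blast
  qed
  then show thesis using that[of rs cs] * dist[of rs cs] by simp
qed

text \<open>The entries of the vector are the cofactors along the last row of the bordered minors. They
  do not depend on that row, so by Laplace expansion the matrix maps the vector to the
  determinants of the bordered minors.\<close>

lemma bordering_vector:
  fixes A :: "int mat"
  assumes tu: "totally_unimodular A"
    and len: "length rs = length cs" and rs: "set rs \<subseteq> {..<dim_row A}"
    and cs: "set cs \<subseteq> {..<dim_col A}" and c: "c < dim_col A"
    and dist: "distinct cs" "c \<notin> set cs"
  obtains y :: "nat \<Rightarrow> int" where
    "\<And>j. j \<notin> insert c (set cs) \<Longrightarrow> y j = 0" "\<And>j. y j \<in> {0, 1, -1}"
    "y c = det (list_minor A rs cs)"
    "\<And>i. i < dim_row A \<Longrightarrow>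
      (\<Sum>j<dim_col A. A $$ (i, j) * y j) = det (list_minor A (rs @ [i]) (cs @ [c]))"
proof -
  let ?k = "length rs"
  define ds where "ds = cs @ [c]"
  have ds: "distinct ds" "length ds = Suc ?k" "set ds = insert c (set cs)"
    using dist len by (auto simp: ds_def)
  define es where "es b = map (\<lambda>j. ds ! (if j < b then j else Suc j)) [0..<?k]" for b
  have es: "set (es b) \<subseteq> {..<dim_col A}" for b
  proof -
    have "set (es b) \<subseteq> set ds" using ds(2) by (auto simp: es_def)
    then show ?thesis using ds(3) cs c by auto
  qed
  define cf where "cf b = (-1) ^ (?k + b) * det (list_minor A rs (es b))" for b
  have cofac: "cofactor (list_minor A (rs @ [i]) ds) ?k b = cf b" for i b
  proof -
    have "mat_delete (list_minor A (rs @ [i]) ds) ?k b = list_minor A rs (es b)"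
      by (rule eq_matI) (auto simp: mat_delete_def list_minor_def es_def nth_append)
    then show ?thesis by (simp add: cofactor_def cf_def)
  qed
  have cf: "cf b \<in> {0, 1, -1}" for b
  proof -
    have "det (list_minor A rs (es b)) \<in> {0, 1, -1}"
      by (rule det_list_minor[OF tu _ rs es]) (simp add: es_def)
    moreover have "(-1::int) ^ (?k + b) = 1 \<or> (-1::int) ^ (?k + b) = -1"
      by (simp add: minus_one_power_iff)
    ultimately show ?thesis by (auto simp: cf_def)
  qed
  define y where "y j = (\<Sum>b<Suc ?k. if ds ! b = j then cf b else 0)" for j
  have y_nth: "y (ds ! b) = cf b" if b: "b < Suc ?k" for b
  proof -
    have "y (ds ! b) = (\<Sum>b'<Suc ?k. if b' = b then cf b' else 0)"
      unfolding y_def using b ds by (intro sum.cong) (auto simp: nth_eq_iff_index_eq)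
    then show ?thesis using b by simp
  qed
  show thesis
  proof (rule that[of y])
    show out: "y j = 0" if "j \<notin> insert c (set cs)" for j
    proof -
      have "ds ! b \<noteq> j" if "b < Suc ?k" for b
        using that ds nth_mem[of b ds] \<open>j \<notin> _\<close> by auto
      then show ?thesis by (simp add: y_def)
    qed
    show "y j \<in> {0, 1, -1}" for j
    proof (cases "j \<in> set ds")
      case True
      then obtain b where "b < Suc ?k" "j = ds ! b" using ds(2) by (metis in_set_conv_nth)
      then show ?thesis using y_nth cf by metis
    next
      case False
      then show ?thesis using out ds(3) by simp
    qed
    have "es ?k = cs"
      by (rule nth_equalityI) (auto simp: es_def ds_def len nth_append)
    then have "cf ?k = det (list_minor A rs cs)" by (simp add: cf_def)
    moreover have "ds ! ?k = c" by (simp add: ds_def len)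
    ultimately show "y c = det (list_minor A rs cs)" using y_nth[of ?k] by simp
    fix i assume i: "i < dim_row A"
    let ?B = "list_minor A (rs @ [i]) ds"
    have inj: "inj_on ((!) ds) {..<Suc ?k}"
      using ds by (auto simp: inj_on_def nth_eq_iff_index_eq)
    have img: "(!) ds ` {..<Suc ?k} = set ds"
      using ds(2) by (auto simp: set_conv_nth)
    have "(\<Sum>j<dim_col A. A $$ (i, j) * y j) = (\<Sum>j\<in>set ds. A $$ (i, j) * y j)"
      using ds(3) cs c out by (intro sum.mono_neutral_right) auto
    also have "\<dots> = (\<Sum>b<Suc ?k. A $$ (i, ds ! b) * y (ds ! b))"
      unfolding img[symmetric] by (subst sum.reindex[OF inj]) simp
    also have "\<dots> = (\<Sum>b<Suc ?k. ?B $$ (?k, b) * cofactor ?B ?k b)"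
    proof (intro sum.cong refl)
      fix b assume b: "b \<in> {..<Suc ?k}"
      then have "?B $$ (?k, b) = A $$ (i, ds ! b)" by (simp add: list_minor_def)
      then show "A $$ (i, ds ! b) * y (ds ! b) = ?B $$ (?k, b) * cofactor ?B ?k b"
        using b by (simp add: y_nth cofac)
    qed
    also have "\<dots> = det ?B"
      using laplace_expansion_row[of ?B "Suc ?k" ?k] list_minor_carrier[of A "rs @ [i]" ds] by simp
    finally show "(\<Sum>j<dim_col A. A $$ (i, j) * y j) = det (list_minor A (rs @ [i]) (cs @ [c]))"
      by (simp add: ds_def)
  qed
qed

text \<open>Cramer's rule modulo \<open>k\<close>: the adjugate of the minor turns the divisibility of the row sums into
  divisibility of the coordinates.\<close>

lemma dvd_solution_of_unimodular_system:
  fixes A :: "int mat"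
  assumes len: "length rs = length cs" and dist: "distinct cs" and cs: "set cs \<subseteq> {..<dim_col A}"
    and det: "\<bar>det (list_minor A rs cs)\<bar> = 1"
    and col: "\<And>j. j < dim_col A \<Longrightarrow> j \<notin> set cs \<Longrightarrow> k dvd w j"
    and row: "\<And>i. i \<in> set rs \<Longrightarrow> k dvd (\<Sum>j<dim_col A. A $$ (i, j) * w j)"
    and c: "c \<in> set cs"
  shows "k dvd w c"
proof -
  let ?B = "list_minor A rs cs" and ?k = "length rs"
  define x where "x = vec ?k (\<lambda>b. w (cs ! b))"
  have x: "x \<in> carrier_vec ?k" by (simp add: x_def)
  have inj: "inj_on ((!) cs) {0..<?k}"
    using dist len by (auto simp: inj_on_def nth_eq_iff_index_eq)
  have img: "(!) cs ` {0..<?k} = set cs"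
    using len by (auto simp: set_conv_nth)
  have Bx: "k dvd (?B *\<^sub>v x) $ a" if a: "a < ?k" for a
  proof -
    let ?f = "\<lambda>j. A $$ (rs ! a, j) * w j"
    have "(?B *\<^sub>v x) $ a = (\<Sum>b = 0..<?k. ?f (cs ! b))"
      using a by (simp add: list_minor_def x_def scalar_prod_def)
    also have "\<dots> = (\<Sum>j\<in>set cs. ?f j)"
      unfolding img[symmetric] by (subst sum.reindex[OF inj]) simp
    also have "\<dots> = (\<Sum>j<dim_col A. ?f j) - (\<Sum>j\<in>{..<dim_col A} - set cs. ?f j)"
      using sum.subset_diff[OF cs, of ?f] by simp
    finally show ?thesis
      using row[of "rs ! a"] col a by (auto intro!: dvd_diff dvd_sum)
  qed
  obtain b where b: "b < ?k" "c = cs ! b" using c len by (metis in_set_conv_nth)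
  have adj: "adj_mat ?B \<in> carrier_mat ?k ?k" "adj_mat ?B * ?B = det ?B \<cdot>\<^sub>m 1\<^sub>m ?k"
    using adj_mat[OF list_minor_carrier] by blast+
  have "adj_mat ?B *\<^sub>v (?B *\<^sub>v x) = (det ?B \<cdot>\<^sub>m 1\<^sub>m ?k) *\<^sub>v x"
    using assoc_mult_mat_vec[OF adj(1) list_minor_carrier[of A rs cs] x] adj(2) by simp
  also have "\<dots> $ b = det ?B * x $ b"
    using b x by (simp add: scalar_prod_def if_distrib[of "(*) _"] if_distrib[of "\<lambda>u. u * _"] cong: if_cong)
  finally have "det ?B * w c = (adj_mat ?B *\<^sub>v (?B *\<^sub>v x)) $ b"
    using b by (simp add: x_def)
  also have "\<dots> = (\<Sum>a = 0..<?k. row (adj_mat ?B) b $ a * (?B *\<^sub>v x) $ a)"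
    using b adj(1) by (simp add: scalar_prod_def list_minor_def)
  also have "k dvd \<dots>" by (intro dvd_sum dvd_mult) (use Bx in auto)
  finally show ?thesis using det by (auto simp: abs_eq_iff' split: if_splits)
qed

text \<open>The \<open>i\<close>-th coordinate of the product of \<open>A\<close> with the column vector \<open>w\<close>, given as a function on the
  column indices.\<close>

definition mat_row_sum :: "int mat \<Rightarrow> (nat \<Rightarrow> int) \<Rightarrow> nat \<Rightarrow> int" where
  "mat_row_sum A w i = (\<Sum>j<dim_col A. A $$ (i, j) * w j)"

text \<open>A direction that leaves unchanged all coordinates and row sums of \<open>w\<close> that are divisible by \<open>k\<close>
  and moves each of the others by at most \<open>1\<close>. A maximal nonsingular minor with rows and columns
  among the divisible row sums and the indivisible coordinates cannot exhaust these columns, by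
  Cramer's rule; bordering it by a remaining column gives the direction.\<close>

lemma totally_unimodular_direction:
  fixes A :: "int mat"
  assumes tu: "totally_unimodular A" and c: "c < dim_col A" "\<not> k dvd w c"
  obtains y :: "nat \<Rightarrow> int" where
    "\<And>j. y j \<in> {0, 1, -1}" "\<And>j. k dvd w j \<Longrightarrow> y j = 0"
    "\<And>i. i < dim_row A \<Longrightarrow> mat_row_sum A y i \<in> {0, 1, -1}"
    "\<And>i. i < dim_row A \<Longrightarrow> k dvd mat_row_sum A w i \<Longrightarrow> mat_row_sum A y i = 0"
    "\<exists>j<dim_col A. y j \<noteq> 0"
proof -
  define R where "R = {i. i < dim_row A \<and> k dvd mat_row_sum A w i}"
  define C where "C = {j. j < dim_col A \<and> \<not> k dvd w j}"
  have "finite C" by (simp add: C_def)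
  then obtain rs cs where *: "length rs = length cs" "set rs \<subseteq> R" "set cs \<subseteq> C" "distinct cs"
    "det (list_minor A rs cs) \<noteq> 0"
    "\<And>i c. i \<in> R \<Longrightarrow> c \<in> C \<Longrightarrow> det (list_minor A (rs @ [i]) (cs @ [c])) = 0"
    using maximal_nonsingular_minor[of C R A] by blast
  have sub: "set rs \<subseteq> {..<dim_row A}" "set cs \<subseteq> {..<dim_col A}"
    using * by (auto simp: R_def C_def)
  have "\<bar>det (list_minor A rs cs)\<bar> = 1"
    using det_list_minor[OF tu *(1) sub] *(5) by auto
  then have "set cs \<noteq> C"
    using dvd_solution_of_unimodular_system[OF *(1,4) sub(2), of k w c] c *(2)
    by (auto simp: C_def R_def mat_row_sum_def)
  then obtain d where d: "d \<in> C" "d \<notin> set cs" using *(3) by blast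
  then have "d < dim_col A" by (simp add: C_def)
  then obtain y :: "nat \<Rightarrow> int" where y:
    "\<And>j. j \<notin> insert d (set cs) \<Longrightarrow> y j = 0" "\<And>j. y j \<in> {0, 1, -1}"
    "y d = det (list_minor A rs cs)"
    "\<And>i. i < dim_row A \<Longrightarrow>
      (\<Sum>j<dim_col A. A $$ (i, j) * y j) = det (list_minor A (rs @ [i]) (cs @ [d]))"
    using bordering_vector[OF tu *(1) sub _ *(4) d(2)] by blast
  show thesis
  proof (rule that[of y])
    show "y j \<in> {0, 1, -1}" for j by (rule y(2))
    show "y j = 0" if "k dvd w j" for j
      using that y(1)[of j] d(1) *(3) by (auto simp: C_def)
    show "mat_row_sum A y i \<in> {0, 1, -1}" if "i < dim_row A" for i
      unfolding mat_row_sum_def y(4)[OF that]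
      using that sub * d by (intro det_list_minor[OF tu]) (auto simp: C_def)
    show "mat_row_sum A y i = 0" if "i < dim_row A" "k dvd mat_row_sum A w i" for i
      using that y(4) *(6)[OF _ d(1)] by (simp add: mat_row_sum_def R_def)
    show "\<exists>j<dim_col A. y j \<noteq> 0"
      using y(3) *(5) \<open>d < dim_col A\<close> by auto
  qed
qed

lemma mat_row_sum_add: "mat_row_sum A (\<lambda>j. v j + w j) i = mat_row_sum A v i + mat_row_sum A w i"
  by (simp add: mat_row_sum_def sum.distrib algebra_simps)

lemma mat_row_sum_cmult: "mat_row_sum A (\<lambda>j. k * w j) i = k * mat_row_sum A w i"
  by (simp add: mat_row_sum_def sum_distrib_left algebra_simps)

text \<open>\<open>same_cell k a b\<close>: the number \<open>b\<close> lies between the two multiples of \<open>k\<close> that enclose \<open>a\<close>;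
  if \<open>a\<close> is itself a multiple of \<open>k\<close>, then \<open>b = a\<close>.\<close>

definition same_cell :: "int \<Rightarrow> int \<Rightarrow> int \<Rightarrow> bool" where
  "same_cell k a b \<longleftrightarrow> (\<forall>l. (k * l \<le> a \<longrightarrow> k * l \<le> b) \<and> (a \<le> k * l \<longrightarrow> b \<le> k * l))"

lemma same_cell_step:
  assumes "same_cell k a b" "e \<in> {0, 1, -1}" "k dvd b \<Longrightarrow> e = 0"
  shows "same_cell k a (b + e)"
proof (cases "k dvd b")
  case True
  then show ?thesis using assms by simp
next
  case False
  have e: "-1 \<le> e" "e \<le> 1" using assms(2) by auto
  show ?thesis unfolding same_cell_def
  proof (intro allI conjI impI)
    fix l
    have ne: "b \<noteq> k * l" using False by auto
    show "k * l \<le> b + e" if "k * l \<le> a"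
    proof -
      have "k * l \<le> b" using assms(1) that unfolding same_cell_def by blast
      then show ?thesis using ne e by linarith
    qed
    show "b + e \<le> k * l" if "a \<le> k * l"
    proof -
      have "b \<le> k * l" using assms(1) that unfolding same_cell_def by blast
      then show ?thesis using ne e by linarith
    qed
  qed
qed

lemma same_cell_abs_le:
  assumes "k \<ge> 1" "same_cell k a b"
  shows "\<bar>b\<bar> \<le> k * \<bar>a\<bar>"
proof -
  have 1: "\<bar>a\<bar> \<le> k * \<bar>a\<bar>" using assms(1) mult_right_mono[of 1 k "\<bar>a\<bar>"] by simp
  then have "a \<le> k * \<bar>a\<bar>" "k * (- \<bar>a\<bar>) \<le> a" by auto
  then have "b \<le> k * \<bar>a\<bar>" "k * (- \<bar>a\<bar>) \<le> b"
    using assms(2) unfolding same_cell_def by blast+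
  then show ?thesis by auto
qed

text \<open>This is the integrality of polyhedra whose constraint matrix is totally unimodular. Among the
  integer vectors all of whose coordinates and row sums stay in the cells of those of \<open>w\<close>, one of
  maximal Euclidean norm has only coordinates divisible by \<open>k\<close>: otherwise it could be moved both
  forwards and backwards along a direction as above, and one of the two moves increases the norm.\<close>

lemma totally_unimodular_rounding:
  fixes A :: "int mat" and w :: "nat \<Rightarrow> int"
  assumes tu: "totally_unimodular A" and k: "k \<ge> 1"
  obtains z where "\<And>j. j < dim_col A \<Longrightarrow> same_cell k (w j) (k * z j)"
    "\<And>i. i < dim_row A \<Longrightarrow> same_cell k (mat_row_sum A w i) (k * mat_row_sum A z i)"
proof -
  define good where "good v \<longleftrightarrow> (\<forall>j<dim_col A. same_cell k (w j) (v j)) \<and>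
     (\<forall>i<dim_row A. same_cell k (mat_row_sum A w i) (mat_row_sum A v i))" for v
  define N where "N v = nat (\<Sum>j<dim_col A. (v j)\<^sup>2)" for v :: "nat \<Rightarrow> int"
  have "N v \<le> nat (\<Sum>j<dim_col A. (k * \<bar>w j\<bar>)\<^sup>2)" if "good v" for v
  proof -
    have "(v j)\<^sup>2 \<le> (k * \<bar>w j\<bar>)\<^sup>2" if "j < dim_col A" for j
      using same_cell_abs_le[OF k, of "w j" "v j"] \<open>good v\<close> that k
      by (simp add: good_def abs_le_square_iff[symmetric] abs_mult)
    then show ?thesis unfolding N_def by (intro nat_mono sum_mono) auto
  qed
  moreover have "good w" by (simp add: good_def same_cell_def)
  ultimately have "\<exists>v. good v \<and> (\<forall>v'. good v' \<longrightarrow> N v' \<le> N v)"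
    by (intro ex_has_greatest_nat[of good w N "Suc _"]) (auto simp: less_Suc_eq_le)
  then obtain v where v: "good v" and max: "\<And>v'. good v' \<Longrightarrow> N v' \<le> N v" by blast
  have div: "k dvd v c" if c: "c < dim_col A" for c
  proof (rule ccontr)
    assume "\<not> k dvd v c"
    then obtain y where y: "\<And>j. y j \<in> {0, 1, -1}" "\<And>j. k dvd v j \<Longrightarrow> y j = 0"
      "\<And>i. i < dim_row A \<Longrightarrow> mat_row_sum A y i \<in> {0, 1, -1}"
      "\<And>i. i < dim_row A \<Longrightarrow> k dvd mat_row_sum A v i \<Longrightarrow> mat_row_sum A y i = 0"
      "\<exists>j<dim_col A. y j \<noteq> 0"
      using totally_unimodular_direction[OF tu c] by blast
    have g: "good (\<lambda>j. v j + e * y j)" if "e = 1 \<or> e = -1" for e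
    proof -
      have "e * y j \<in> {0, 1, -1}" for j using y(1)[of j] that by auto
      then have "same_cell k (w j) (v j + e * y j)" if "j < dim_col A" for j
        using v y(2) that by (intro same_cell_step) (auto simp: good_def)
      moreover have "e * mat_row_sum A y i \<in> {0, 1, -1}" if "i < dim_row A" for i
        using y(3)[OF that] \<open>e = 1 \<or> e = -1\<close> by auto
      then have "same_cell k (mat_row_sum A w i) (mat_row_sum A v i + e * mat_row_sum A y i)"
        if "i < dim_row A" for i
        using v y(4) that by (intro same_cell_step) (auto simp: good_def)
      ultimately show ?thesis
        by (simp add: good_def mat_row_sum_add mat_row_sum_cmult)
    qed
    let ?s = "\<lambda>f. \<Sum>j<dim_col A. (f j :: int)\<^sup>2"
    have "?s (\<lambda>j. v j + 1 * y j) \<le> ?s v" "?s (\<lambda>j. v j + (-1) * y j) \<le> ?s v"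
      using max[OF g[of 1]] max[OF g[of "-1"]] unfolding N_def
      by (simp_all add: nat_le_eq_zle sum_nonneg nat_le_iff)
    moreover have "?s (\<lambda>j. v j + 1 * y j) + ?s (\<lambda>j. v j + (-1) * y j) = 2 * ?s v + 2 * ?s y"
      by (simp add: sum.distrib[symmetric] sum_distrib_left power2_eq_square algebra_simps)
    \<comment> \<open>The parallelogram law rules out that neither move increases the norm.\<close>
    ultimately have "?s y \<le> 0" by linarith
    moreover obtain j where "j < dim_col A" "y j \<noteq> 0" using y(5) by blast
    then have "0 < ?s y" by (intro sum_pos2[of _ j]) auto
    ultimately show False by simp
  qed
  define z where "z j = v j div k" for j
  have z: "k * z j = v j" if "j < dim_col A" for j using div[OF that] by (simp add: z_def)
  have "k * mat_row_sum A z i = mat_row_sum A v i" for i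
    by (simp add: mat_row_sum_def sum_distrib_left z[symmetric] algebra_simps)
  then show thesis using that[of z] v z by (simp add: good_def)
qed

section \<open>Monomial ideals\<close>

text \<open>The total exponent of the monomial \<open>m\<close> in the variables indexed by \<open>F\<close>.\<close>

definition wt :: "nat set \<Rightarrow> (nat \<Rightarrow>\<^sub>0 nat) \<Rightarrow> nat" where
  "wt F m = (\<Sum>j\<in>F. Poly_Mapping.lookup m j)"

lemma wt_add [simp]: "wt F (a + b) = wt F a + wt F b"
  by (simp add: wt_def lookup_add sum.distrib)

lemma wt_single [simp]:
  "finite F \<Longrightarrow> wt F (Poly_Mapping.single j c) = (if j \<in> F then c else 0)"
  by (simp add: wt_def lookup_single when_def)

lemma one_le_wt_iff:
  assumes "finite F"
  shows "1 \<le> wt F m \<longleftrightarrow> (\<exists>j\<in>F. j \<in> Poly_Mapping.keys m)"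
proof -
  have "1 \<le> wt F m \<longleftrightarrow> wt F m \<noteq> 0" by linarith
  also have "\<dots> \<longleftrightarrow> (\<exists>j\<in>F. j \<in> Poly_Mapping.keys m)"
    using assms by (simp add: wt_def in_keys_iff)
  finally show ?thesis .
qed

lemma wt_mono: "finite G \<Longrightarrow> F \<subseteq> G \<Longrightarrow> wt F m \<le> wt G m"
  by (simp add: wt_def sum_mono2)

lemma wt_keys: "finite F \<Longrightarrow> Poly_Mapping.keys m \<subseteq> F \<Longrightarrow> wt (Poly_Mapping.keys m) m = wt F m"
  unfolding wt_def by (intro sum.mono_neutral_left) (auto simp: in_keys_iff)

lemma keys_add_nat: "Poly_Mapping.keys (a + b) = Poly_Mapping.keys a \<union> Poly_Mapping.keys (b :: 'a \<Rightarrow>\<^sub>0 nat)"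
  by (auto simp: in_keys_iff lookup_add)

lemma poly_ring_simps [simp]:
  "monoid.mult (poly_ring n) = (*)" "one (poly_ring n) = 1" "zero (poly_ring n) = 0"
  "add (poly_ring n) = (+)"
  by (simp_all add: poly_ring_def)

lemma in_poly_ring_iff:
  "p \<in> carrier (poly_ring n) \<longleftrightarrow> (\<forall>m\<in>Poly_Mapping.keys p. Poly_Mapping.keys m \<subseteq> {1..n})"
  by (simp add: poly_ring_def)

text \<open>The polynomials in \<open>x\<^sub>1, ..., x\<^sub>n\<close> all of whose monomials belong to \<open>U\<close>.\<close>

definition mon_span :: "nat \<Rightarrow> (nat \<Rightarrow>\<^sub>0 nat) set \<Rightarrow> 'k::field mpoly set" where
  "mon_span n U = {p. \<forall>m\<in>Poly_Mapping.keys p. Poly_Mapping.keys m \<subseteq> {1..n} \<and> m \<in> U}"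

lemma mon_span_subset_carrier: "mon_span n U \<subseteq> carrier (poly_ring n)"
  by (auto simp: mon_span_def in_poly_ring_iff)

lemma mon_span_UNIV: "mon_span n UNIV = carrier (poly_ring n)"
  by (intro equalityI subsetI) (simp_all add: mon_span_def in_poly_ring_iff)

lemma mon_span_add: "p \<in> mon_span n U \<Longrightarrow> q \<in> mon_span n U \<Longrightarrow> p + q \<in> mon_span n U"
  using Poly_Mapping.keys_add[of p q] by (auto simp: mon_span_def)

lemma keys_mult_obtain:
  fixes p q :: "'k::field mpoly"
  assumes "m \<in> Poly_Mapping.keys (p * q)"
  obtains a b where "m = a + b" "a \<in> Poly_Mapping.keys p" "b \<in> Poly_Mapping.keys q"
  using keys_mult[of p q] assms by blast

lemma mon_span_mult:
  assumes "p \<in> mon_span n U" "q \<in> mon_span n V" and "\<And>a b. a \<in> U \<Longrightarrow> b \<in> V \<Longrightarrow> a + b \<in> W"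
  shows "p * q \<in> mon_span n W"
  unfolding mon_span_def
proof (intro CollectI ballI)
  fix m assume "m \<in> Poly_Mapping.keys (p * q)"
  then obtain a b where *: "m = a + b" "a \<in> Poly_Mapping.keys p" "b \<in> Poly_Mapping.keys q"
    by (rule keys_mult_obtain)
  then have "Poly_Mapping.keys a \<subseteq> {1..n}" "a \<in> U" "Poly_Mapping.keys b \<subseteq> {1..n}" "b \<in> V"
    using assms(1,2) by (auto simp: mon_span_def)
  then show "Poly_Mapping.keys m \<subseteq> {1..n} \<and> m \<in> W"
    using assms(3) * by (simp add: keys_add_nat)
qed

lemma lookup_times_single:
  fixes g :: "'k::field mpoly"
  shows "Poly_Mapping.lookup (g * Poly_Mapping.single a c) (m + a) = Poly_Mapping.lookup g m * c"
proof -
  have "(\<Sum>q. Poly_Mapping.lookup (Poly_Mapping.single a c) q when m + a = l + q) = (c when l = m)" for l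
  proof -
    have "(\<Sum>q. Poly_Mapping.lookup (Poly_Mapping.single a c) q when m + a = l + q) =
        (\<Sum>q. (c when l = m) when q = a)"
      by (rule arg_cong[of _ _ Sum_any]) (auto simp: lookup_single when_def)
    then show ?thesis by simp
  qed
  then show ?thesis by (simp add: lookup_mult mult_when)
qed

lemma mon_span_single:
  "Poly_Mapping.keys m \<subseteq> {1..n} \<Longrightarrow> m \<in> U \<Longrightarrow> Poly_Mapping.single m c \<in> mon_span n U"
  by (simp add: mon_span_def)

lemma poly_mapping_eq_sum_singles:
  "p = (\<Sum>m\<in>Poly_Mapping.keys p. Poly_Mapping.single m (Poly_Mapping.lookup p m))"
  by (rule poly_mapping_eqI)
     (auto simp: lookup_sum lookup_single when_def in_keys_iff)

lemma mon_span_subsetI: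
  fixes X :: "'k::field mpoly set"
  assumes zero: "0 \<in> X" and add: "\<And>p q. p \<in> X \<Longrightarrow> q \<in> X \<Longrightarrow> p + q \<in> X"
    and single: "\<And>m c. Poly_Mapping.keys m \<subseteq> {1..n} \<Longrightarrow> m \<in> U \<Longrightarrow> Poly_Mapping.single m c \<in> X"
  shows "mon_span n U \<subseteq> X"
proof
  fix p :: "'k mpoly" assume p: "p \<in> mon_span n U"
  have "(\<Sum>m\<in>M. Poly_Mapping.single m (Poly_Mapping.lookup p m)) \<in> X"
    if "finite M" "M \<subseteq> Poly_Mapping.keys p" for M
    using that
  proof (induction M)
    case (insert m M)
    then have "Poly_Mapping.keys m \<subseteq> {1..n}" "m \<in> U" using p by (simp_all add: mon_span_def)
    then show ?case using insert by (simp add: add single)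
  qed (simp add: zero)
  then show "p \<in> X"
    using poly_mapping_eq_sum_singles[of p] by (metis finite_keys order_refl)
qed

lemma a_inv_poly_ring:
  assumes "p \<in> carrier (poly_ring n :: 'k::field mpoly ring)"
  shows "\<ominus>\<^bsub>poly_ring n\<^esub> p = - p"
proof -
  interpret cring "poly_ring n :: 'k mpoly ring" by (rule cring_poly_ring)
  have "- p \<in> carrier (poly_ring n)" using assms by (simp add: in_poly_ring_iff)
  then show ?thesis using minus_equality[of "- p" p] assms by simp
qed

lemma mon_span_ideal:
  assumes "\<And>a b. a \<in> U \<Longrightarrow> a + b \<in> U"
  shows "ideal (mon_span n U) (poly_ring n :: 'k::field mpoly ring)"
proof (rule idealI)
  interpret cring "poly_ring n :: 'k mpoly ring" by (rule cring_poly_ring)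
  show "ring (poly_ring n :: 'k mpoly ring)" by (rule ring_axioms)
  show "subgroup (mon_span n U) (add_monoid (poly_ring n :: 'k mpoly ring))"
  proof
    fix p :: "'k mpoly" assume p: "p \<in> mon_span n U"
    then have "- p \<in> mon_span n U" by (simp add: mon_span_def)
    then show "inv\<^bsub>add_monoid (poly_ring n)\<^esub> p \<in> mon_span n U"
      using a_inv_poly_ring[of p n] p mon_span_subset_carrier[of n U] unfolding a_inv_def by auto
  qed (use mon_span_subset_carrier in \<open>auto simp: mon_span_add\<close>, simp add: mon_span_def)
  fix a x :: "'k mpoly" assume *: "a \<in> mon_span n U" "x \<in> carrier (poly_ring n)"
  then have "a * x \<in> mon_span n U"
    using mon_span_mult[of a n U x UNIV U] assms by (simp add: mon_span_UNIV)
  then show "x \<otimes>\<^bsub>poly_ring n\<^esub> a \<in> mon_span n U" "a \<otimes>\<^bsub>poly_ring n\<^esub> x \<in> mon_span n U"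
    by (simp_all add: mult.commute)
qed

lemma ideal_prod_mon_span:
  assumes sum: "\<And>a b. a \<in> U \<Longrightarrow> b \<in> V \<Longrightarrow> a + b \<in> W"
    and split: "\<And>m. m \<in> W \<Longrightarrow> Poly_Mapping.keys m \<subseteq> {1..n} \<Longrightarrow> \<exists>a\<in>U. \<exists>b\<in>V. m = a + b"
  shows "ideal_prod (poly_ring n) (mon_span n U) (mon_span n V) = (mon_span n W :: 'k::field mpoly set)"
    (is "?P = _")
proof
  show "?P \<subseteq> mon_span n W"
  proof
    fix p assume "p \<in> ?P"
    then show "p \<in> mon_span n W"
      by induction (auto intro: mon_span_mult[OF _ _ sum] mon_span_add)
  qed
  show "mon_span n W \<subseteq> ?P"
  proof (rule mon_span_subsetI)
    have "0 \<in> mon_span n U" "0 \<in> mon_span n V" by (simp_all add: mon_span_def)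
    then show "0 \<in> ?P" using ideal_prod.prod[of 0 "mon_span n U" 0 "mon_span n V" "poly_ring n"] by simp
    show "p + q \<in> ?P" if "p \<in> ?P" "q \<in> ?P" for p q
      using ideal_prod.sum[OF that] by simp
    fix m and c :: 'k assume m: "Poly_Mapping.keys m \<subseteq> {1..n}" "m \<in> W"
    then obtain a b where ab: "a \<in> U" "b \<in> V" "m = a + b" using split by blast
    then have "Poly_Mapping.single a c \<in> mon_span n U" "Poly_Mapping.single b (1::'k) \<in> mon_span n V"
      using m by (auto intro!: mon_span_single simp: keys_add_nat)
    from ideal_prod.prod[OF this, of "poly_ring n"] show "Poly_Mapping.single m c \<in> ?P"
      by (simp add: mult_single ab)
  qed
qed

lemma var_ideal_eq_mon_span:
  assumes F: "F \<subseteq> {1..n}"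
  shows "(var_ideal n F :: 'k::field mpoly set) = mon_span n {m. 1 \<le> wt F m}"
proof
  interpret cring "poly_ring n :: 'k mpoly ring" by (rule cring_poly_ring)
  have fin: "finite F" using F finite_subset by blast
  have var: "(var ` F :: 'k mpoly set) \<subseteq> mon_span n {m. 1 \<le> wt F m}"
    using F fin by (auto simp: var_def intro!: mon_span_single)
  show "(var_ideal n F :: 'k mpoly set) \<subseteq> mon_span n {m. 1 \<le> wt F m}"
    unfolding var_ideal_def by (rule genideal_minimal[OF mon_span_ideal var]) simp
  have carr: "(var ` F :: 'k mpoly set) \<subseteq> carrier (poly_ring n)"
    using var mon_span_subset_carrier by blast
  have id: "ideal (var_ideal n F :: 'k mpoly set) (poly_ring n)"
    unfolding var_ideal_def by (rule genideal_ideal[OF carr])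
  show "mon_span n {m. 1 \<le> wt F m} \<subseteq> (var_ideal n F :: 'k mpoly set)"
  proof (rule mon_span_subsetI)
    show "0 \<in> (var_ideal n F :: 'k mpoly set)"
      using additive_subgroup.zero_closed[OF ideal.axioms(1)[OF id]] by simp
    show "p + q \<in> var_ideal n F" if "p \<in> var_ideal n F" "q \<in> var_ideal n F" for p q :: "'k mpoly"
      using additive_subgroup.a_closed[OF ideal.axioms(1)[OF id] that] by simp
    fix m and c :: 'k assume m: "Poly_Mapping.keys m \<subseteq> {1..n}" "m \<in> {m. 1 \<le> wt F m}"
    then obtain j where j: "j \<in> F" "j \<in> Poly_Mapping.keys m" using one_le_wt_iff[OF fin] by blast
    let ?r = "m - Poly_Mapping.single j 1"
    have m_eq: "?r + Poly_Mapping.single j 1 = m"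
      by (rule poly_mapping_eqI) (use j in \<open>auto simp: lookup_add lookup_minus lookup_single when_def in_keys_iff\<close>)
    then have "Poly_Mapping.keys ?r \<subseteq> {1..n}" using m(1) by (metis keys_add_nat le_sup_iff)
    then have r: "Poly_Mapping.single ?r c \<in> carrier (poly_ring n)" by (simp add: in_poly_ring_iff)
    have v: "var j \<in> (var_ideal n F :: 'k mpoly set)"
      unfolding var_ideal_def using genideal_self[OF carr] j(1) by blast
    have "Poly_Mapping.single m c = Poly_Mapping.single ?r c * var j"
      by (simp only: var_def mult_single m_eq mult_1_right)
    then show "Poly_Mapping.single m c \<in> (var_ideal n F :: 'k mpoly set)"
      using ideal.I_l_closed[OF id v r] by simp
  qed
qed

lemma var_in_var_ideal:
  assumes "F \<subseteq> {1..n}" "j \<in> F"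
  shows "(var j :: 'k::field mpoly) \<in> var_ideal n F"
  unfolding var_ideal_eq_mon_span[OF assms(1)] var_def
  using assms finite_subset[OF assms(1)] by (intro mon_span_single) auto

text \<open>The lowest \<open>F\<close>-degree of a product is the sum of the lowest \<open>F\<close>-degrees of the factors,
  because the product of the lowest parts does not vanish.\<close>

lemma lowest_wt_mult:
  fixes f g :: "'k::field mpoly"
  assumes f: "a \<in> Poly_Mapping.keys f" "wt F a < t"
    and g: "b \<in> Poly_Mapping.keys g" "wt F b = 0"
  obtains m where "m \<in> Poly_Mapping.keys (g * f)" "wt F m < t"
proof -
  define part where "part d p = (\<Sum>m\<in>{m \<in> Poly_Mapping.keys p. wt F m = d}.
      Poly_Mapping.single m (Poly_Mapping.lookup p m))" for d and p :: "'k mpoly"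
  have lookup_part: "Poly_Mapping.lookup (part d p) m = (if wt F m = d then Poly_Mapping.lookup p m else 0)"
    for d m and p :: "'k mpoly"
    by (auto simp: part_def lookup_sum lookup_single when_def in_keys_iff)
  define d where "d = Min (wt F ` Poly_Mapping.keys f)"
  have "d \<in> wt F ` Poly_Mapping.keys f" unfolding d_def using f by (intro Min_in) auto
  then obtain a' where a': "a' \<in> Poly_Mapping.keys f" "wt F a' = d" by blast
  have d_le: "d \<le> wt F m" if "m \<in> Poly_Mapping.keys f" for m
    using that by (simp add: d_def)
  have d: "d < t" using d_le[OF f(1)] f(2) by simp
  let ?f = "part d f" and ?g = "part 0 g"
  have "Poly_Mapping.lookup ?f a' \<noteq> 0" "Poly_Mapping.lookup ?g b \<noteq> 0"
    using a' g by (auto simp: lookup_part in_keys_iff)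
  then have "?f \<noteq> 0" "?g \<noteq> 0" by auto
  then have "?g * ?f \<noteq> 0" by simp
  then obtain m where m: "m \<in> Poly_Mapping.keys (?g * ?f)" by (meson all_not_in_conv keys_eq_empty)
  obtain u v where "m = u + v" "u \<in> Poly_Mapping.keys ?g" "v \<in> Poly_Mapping.keys ?f"
    using m by (rule keys_mult_obtain)
  then have wtm: "wt F m = d" by (auto simp: in_keys_iff lookup_part split: if_splits)
  have low: "d < wt F x" if x: "x \<in> Poly_Mapping.keys ((g - ?g) * f)" for x
  proof -
    obtain u v where uv: "x = u + v" "u \<in> Poly_Mapping.keys (g - ?g)" "v \<in> Poly_Mapping.keys f"
      using x by (rule keys_mult_obtain)
    have "wt F u \<noteq> 0" using uv(2) by (auto simp: in_keys_iff lookup_minus lookup_part split: if_splits)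
    then show ?thesis using uv d_le by fastforce
  qed
  have low': "d < wt F x" if x: "x \<in> Poly_Mapping.keys (?g * (f - ?f))" for x
  proof -
    obtain u v where uv: "x = u + v" "u \<in> Poly_Mapping.keys ?g" "v \<in> Poly_Mapping.keys (f - ?f)"
      using x by (rule keys_mult_obtain)
    have "wt F v \<noteq> d" "v \<in> Poly_Mapping.keys f"
      using uv(3) by (auto simp: in_keys_iff lookup_minus lookup_part split: if_splits)
    then show ?thesis using uv d_le[of v] by simp
  qed
  have "g * f = ?g * ?f + (g - ?g) * f + ?g * (f - ?f)" by (simp add: algebra_simps)
  then have "Poly_Mapping.lookup (g * f) m = Poly_Mapping.lookup (?g * ?f) m"
    using low[of m] low'[of m] wtm by (simp add: lookup_add not_in_keys_iff_lookup_eq_zero[symmetric])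
       (metis add_cancel_right_right less_irrefl not_in_keys_iff_lookup_eq_zero)
  then have "m \<in> Poly_Mapping.keys (g * f)" using m by (simp add: in_keys_iff)
  then show thesis using that wtm d by simp
qed

lemma primeideal_var_ideal:
  assumes F: "F \<subseteq> {1..n}"
  shows "primeideal (var_ideal n F) (poly_ring n :: 'k::field mpoly ring)"
proof (rule primeidealI)
  show "ideal (var_ideal n F) (poly_ring n :: 'k mpoly ring)"
    unfolding var_ideal_eq_mon_span[OF F] by (rule mon_span_ideal) simp
  show "cring (poly_ring n :: 'k mpoly ring)" by (rule cring_poly_ring)
  have "(1 :: 'k mpoly) \<notin> var_ideal n F"
    unfolding var_ideal_eq_mon_span[OF F] by (simp add: mon_span_def wt_def)
  moreover have "(1 :: 'k mpoly) \<in> carrier (poly_ring n)" by (simp add: in_poly_ring_iff)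
  ultimately show "carrier (poly_ring n :: 'k mpoly ring) \<noteq> var_ideal n F" by blast
  fix p q :: "'k mpoly"
  assume *: "p \<in> carrier (poly_ring n)" "q \<in> carrier (poly_ring n)"
    "p \<otimes>\<^bsub>poly_ring n\<^esub> q \<in> var_ideal n F"
  show "p \<in> var_ideal n F \<or> q \<in> var_ideal n F"
  proof (rule ccontr)
    assume "\<not> ?thesis"
    then obtain a b where "b \<in> Poly_Mapping.keys p" "wt F b = 0" "a \<in> Poly_Mapping.keys q" "wt F a < 1"
      using * by (auto simp: var_ideal_eq_mon_span[OF F] mon_span_def in_poly_ring_iff)
    then obtain m where "m \<in> Poly_Mapping.keys (p * q)" "wt F m < 1"
      by (metis lowest_wt_mult)
    then show False using *(3) by (auto simp: var_ideal_eq_mon_span[OF F] mon_span_def)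
  qed
qed

section \<open>Powers of the cover ideal\<close>

text \<open>The monomials with \<open>wt\<close> at least \<open>t\<close> on every edge. Those in \<open>x\<^sub>1, ..., x\<^sub>n\<close> span the \<open>t\<close>-th symbolic
  power of the cover ideal of a hypergraph.\<close>

definition cover_monomials :: "nat set list \<Rightarrow> nat \<Rightarrow> (nat \<Rightarrow>\<^sub>0 nat) set" where
  "cover_monomials Fs t = {m. \<forall>F\<in>set Fs. t \<le> wt F m}"

lemma hypergraph_edge:
  assumes "hypergraph n Fs" "F \<in> set Fs"
  shows "F \<noteq> {}" "F \<subseteq> {1..n}" "finite F"
  using assms finite_subset[of F "{1..n}"] by (auto simp: hypergraph_def)

lemma hypergraph_antichain:
  assumes "hypergraph n Fs" "F \<in> set Fs" "G \<in> set Fs" "F \<subseteq> G"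
  shows "F = G"
  using assms unfolding hypergraph_def by (metis in_set_conv_nth)

lemma cover_ideal_eq_mon_span:
  assumes "hypergraph n Fs"
  shows "(cover_ideal n Fs :: 'k::field mpoly set) = mon_span n (cover_monomials Fs 1)"
proof -
  have "(cover_ideal n Fs :: 'k mpoly set) = (\<Inter>F\<in>set Fs. mon_span n {m. 1 \<le> wt F m})"
    unfolding cover_ideal_def by (intro INF_cong refl var_ideal_eq_mon_span hypergraph_edge(2)[OF assms])
  also have "\<dots> = mon_span n (cover_monomials Fs 1)"
  proof (intro equalityI subsetI)
    fix p :: "'k mpoly" assume p: "p \<in> (\<Inter>F\<in>set Fs. mon_span n {m. 1 \<le> wt F m})"
    have "hd Fs \<in> set Fs" using assms by (simp add: hypergraph_def)
    then have "Poly_Mapping.keys m \<subseteq> {1..n}" if "m \<in> Poly_Mapping.keys p" for m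
      using p that unfolding mon_span_def by blast
    moreover have "1 \<le> wt F m" if "m \<in> Poly_Mapping.keys p" "F \<in> set Fs" for m F
      using p that unfolding mon_span_def by blast
    ultimately show "p \<in> mon_span n (cover_monomials Fs 1)"
      by (simp add: mon_span_def cover_monomials_def)
  qed (simp add: mon_span_def cover_monomials_def)
  finally show ?thesis .
qed

text \<open>For \<open>k * z\<close> in the cell of \<open>w\<close>, the bounds on \<open>w / k\<close> by integers pass to \<open>z\<close> and to
  \<open>(w - z) / (k - 1)\<close>; so cutting off \<open>z\<close> can be repeated.\<close>

lemma same_cell_split:
  assumes k: "k \<ge> 1" and c: "same_cell k w (k * z)"
  shows "k * l \<le> w \<Longrightarrow> l \<le> z \<and> (k - 1) * l \<le> w - z"
    and "w \<le> k * l \<Longrightarrow> z \<le> l \<and> w - z \<le> (k - 1) * l"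
proof -
  have up: "w \<le> k * l' \<Longrightarrow> z \<le> l'" and lo: "k * l' \<le> w \<Longrightarrow> l' \<le> z" for l'
    using c k unfolding same_cell_def by (simp_all add: mult_le_cancel_left_pos)
  have mono: "r \<le> k * r" if "r \<ge> 0" for r using that k mult_right_mono[of 1 k r] by simp
  show "l \<le> z \<and> (k - 1) * l \<le> w - z" if "k * l \<le> w"
    using up[of "l + (w - k * l)"] lo[of l] mono[of "w - k * l"] that by (simp add: algebra_simps)
  show "z \<le> l \<and> w - z \<le> (k - 1) * l" if "w \<le> k * l"
    using lo[of "l - (k * l - w)"] up[of l] mono[of "k * l - w"] that by (simp add: algebra_simps)
qed

text \<open>Integer decomposition: a monomial is cut into a \<open>k\<close>-th part and a rest that is fit to be cut
  into \<open>k - 1\<close> further parts.\<close>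

lemma unimodular_split:
  assumes H: "unimodular_hypergraph n Fs" and k: "k \<ge> 1" and m: "Poly_Mapping.keys m \<subseteq> {1..n}"
  obtains z r where "m = z + r"
    "\<And>F l. F \<in> set Fs \<Longrightarrow> k * l \<le> wt F m \<Longrightarrow> l \<le> wt F z \<and> (k - 1) * l \<le> wt F r"
    "\<And>F l. F \<in> set Fs \<Longrightarrow> wt F m \<le> k * l \<Longrightarrow> wt F z \<le> l \<and> wt F r \<le> (k - 1) * l"
proof -
  let ?A = "incidence_mat n Fs"
  have hg: "hypergraph n Fs" and tu: "totally_unimodular ?A"
    using H by (auto simp: unimodular_hypergraph_def)
  have dim: "dim_row ?A = length Fs" "dim_col ?A = n" by (simp_all add: incidence_mat_def)
  define w where "w j = int (Poly_Mapping.lookup m (j + 1))" for j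
  have k': "int k \<ge> 1" using k by simp
  obtain x where x: "\<And>j. j < n \<Longrightarrow> same_cell (int k) (w j) (int k * x j)"
    "\<And>i. i < length Fs \<Longrightarrow> same_cell (int k) (mat_row_sum ?A w i) (int k * mat_row_sum ?A x i)"
    using totally_unimodular_rounding[OF tu k', of w] unfolding dim by blast
  have x_nonneg: "0 \<le> x j" if "j < n" for j
    using same_cell_split(1)[OF k' x(1)[OF that], of 0] by (simp add: w_def)
  have x_le: "x j \<le> w j" if "j < n" for j
  proof -
    have "w j \<le> int k * w j" using k' mult_right_mono[of 1 "int k" "w j"] by (simp add: w_def)
    then show ?thesis using same_cell_split(2)[OF k' x(1)[OF that]] by blast
  qed
  define z where "z = Abs_poly_mapping (\<lambda>j. if j \<in> {1..n} then nat (x (j - 1)) else 0)"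
  have "finite {j. (if j \<in> {1..n} then nat (x (j - 1)) else 0) \<noteq> 0}"
    by (rule finite_subset[of _ "{1..n}"]) auto
  then have z: "Poly_Mapping.lookup z j = (if j \<in> {1..n} then nat (x (j - 1)) else 0)" for j
    by (simp add: z_def)
  have "Poly_Mapping.lookup z j \<le> Poly_Mapping.lookup m j" for j
    using x_le[of "j - 1"] z[of j] by (cases "j \<in> {1..n}") (auto simp: w_def nat_le_iff)
  then have m_eq: "m = z + (m - z)"
    by (intro poly_mapping_eqI) (simp add: lookup_add lookup_minus)
  have row: "mat_row_sum ?A v i = (\<Sum>j\<in>Fs ! i. v (j - 1))" if i: "i < length Fs" for i v
  proof -
    have F: "Fs ! i \<subseteq> {1..n}" using hypergraph_edge(2)[OF hg] i by simp
    have "mat_row_sum ?A v i = (\<Sum>j<n. if j + 1 \<in> Fs ! i then v j else 0)"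
      unfolding mat_row_sum_def dim using i by (intro sum.cong) (auto simp: incidence_mat_def)
    also have "\<dots> = (\<Sum>j\<in>{1..n}. if j \<in> Fs ! i then v (j - 1) else 0)"
      by (rule sum.reindex_bij_witness[of _ "\<lambda>j. j - 1" "\<lambda>j. j + 1"]) auto
    also have "\<dots> = (\<Sum>j\<in>Fs ! i. v (j - 1))"
      using F by (simp add: sum.If_cases Int_absorb1)
    finally show ?thesis .
  qed
  have cell: "same_cell (int k) (int (wt F m)) (int k * int (wt F z))" if FFs: "F \<in> set Fs" for F
  proof -
    obtain i where i: "i < length Fs" "F = Fs ! i" using FFs by (metis in_set_conv_nth)
    have F: "F \<subseteq> {1..n}" using hypergraph_edge(2)[OF hg FFs] .
    have "mat_row_sum ?A w i = int (wt F m)"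
      unfolding row[OF i(1)] wt_def i(2)[symmetric] of_nat_sum
      using F by (intro sum.cong) (auto simp: w_def)
    moreover have "mat_row_sum ?A x i = int (wt F z)"
      unfolding row[OF i(1)] wt_def i(2)[symmetric] of_nat_sum
    proof (intro sum.cong refl)
      fix j assume "j \<in> F"
      then have "j \<in> {1..n}" using F by blast
      then show "x (j - 1) = int (Poly_Mapping.lookup z j)"
        using x_nonneg[of "j - 1"] by (auto simp: z)
    qed
    ultimately show ?thesis using x(2)[OF i(1)] by simp
  qed
  have rest: "int (wt F (m - z)) = int (wt F m) - int (wt F z)" for F
    using arg_cong[OF m_eq, of "\<lambda>u. int (wt F u)"] by simp
  have km: "int ((k - 1) * l) = (int k - 1) * int l" for l
    using k by (simp add: of_nat_diff)
  show thesis
  proof (rule that[OF m_eq])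
    show "l \<le> wt F z \<and> (k - 1) * l \<le> wt F (m - z)" if "F \<in> set Fs" "k * l \<le> wt F m" for F l
    proof -
      have "int k * int l \<le> int (wt F m)" using that(2) by (metis of_nat_le_iff of_nat_mult)
      from same_cell_split(1)[OF k' cell[OF that(1)] this]
      show ?thesis unfolding rest[symmetric] km[symmetric] of_nat_le_iff .
    qed
    show "wt F z \<le> l \<and> wt F (m - z) \<le> (k - 1) * l" if "F \<in> set Fs" "wt F m \<le> k * l" for F l
    proof -
      have "int (wt F m) \<le> int k * int l" using that(2) by (metis of_nat_le_iff of_nat_mult)
      from same_cell_split(2)[OF k' cell[OF that(1)] this]
      show ?thesis unfolding rest[symmetric] km[symmetric] of_nat_le_iff .
    qed
  qed
qed

lemma ideal_power_cover_ideal: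
  assumes H: "unimodular_hypergraph n Fs"
  shows "ideal_power n (cover_ideal n Fs) t = (mon_span n (cover_monomials Fs t) :: 'k::field mpoly set)"
proof (induction t)
  case 0
  have "cover_monomials Fs 0 = UNIV" by (simp add: cover_monomials_def)
  then show ?case by (simp add: ideal_power_def nat_pow_def ideals_set_def mon_span_UNIV)
next
  case (Suc t)
  have hg: "hypergraph n Fs" using H by (simp add: unimodular_hypergraph_def)
  have "ideal_power n (cover_ideal n Fs :: 'k mpoly set) (Suc t) =
      ideal_prod (poly_ring n) (ideal_power n (cover_ideal n Fs) t) (cover_ideal n Fs)"
    by (simp add: ideal_power_def nat_pow_def ideals_set_def)
  also have "\<dots> = ideal_prod (poly_ring n) (mon_span n (cover_monomials Fs t))
      (mon_span n (cover_monomials Fs 1))"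
    by (simp only: Suc) (simp only: cover_ideal_eq_mon_span[OF hg])
  also have "\<dots> = mon_span n (cover_monomials Fs (Suc t))"
  proof (rule ideal_prod_mon_span)
    show "a + b \<in> cover_monomials Fs (Suc t)" if "a \<in> cover_monomials Fs t" "b \<in> cover_monomials Fs 1"
      for a b using that by (force simp: cover_monomials_def)
    fix m assume m: "m \<in> cover_monomials Fs (Suc t)" "Poly_Mapping.keys m \<subseteq> {1..n}"
    obtain z r where zr: "m = z + r"
      "\<And>F l. F \<in> set Fs \<Longrightarrow> Suc t * l \<le> wt F m \<Longrightarrow> l \<le> wt F z \<and> (Suc t - 1) * l \<le> wt F r"
      by (rule unimodular_split[OF H _ m(2), of "Suc t"]) (simp, rule that)
    have "1 \<le> wt F z \<and> t \<le> wt F r" if "F \<in> set Fs" for F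
      using zr(2)[OF that, of 1] m(1) that by (simp add: cover_monomials_def)
    then show "\<exists>a\<in>cover_monomials Fs t. \<exists>b\<in>cover_monomials Fs 1. m = a + b"
      using zr(1) by (intro bexI[of _ r] bexI[of _ z]) (auto simp: cover_monomials_def add.commute)
  qed
  finally show ?case .
qed

section \<open>Local v-numbers as integer programs\<close>

text \<open>For a unimodular hypergraph and \<open>t \<ge> 1\<close>, these are the monomials \<open>a\<close> for which the colon of the
  \<open>t\<close>-th power of the cover ideal by \<open>a\<close> is the prime of the edge \<open>F\<close>. The equation \<open>wt F a = t - 1\<close> is
  written without subtraction, so that there are none for \<open>t = 0\<close>.\<close>

definition witness_monomials :: "nat \<Rightarrow> nat set list \<Rightarrow> nat set \<Rightarrow> nat \<Rightarrow> (nat \<Rightarrow>\<^sub>0 nat) set" where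
  "witness_monomials n Fs F t = {a. Poly_Mapping.keys a \<subseteq> {1..n} \<and> wt F a + 1 = t \<and>
     (\<forall>G\<in>set Fs - {F}. t \<le> wt G a)}"

lemma homogeneous_componentD:
  assumes "f \<in> homogeneous_component n d" "m \<in> Poly_Mapping.keys f"
  shows "Poly_Mapping.keys m \<subseteq> {1..n}" "wt {1..n} m = d"
proof -
  show "Poly_Mapping.keys m \<subseteq> {1..n}"
    using assms by (auto simp: homogeneous_component_def in_poly_ring_iff)
  then have "wt {1..n} m = wt (Poly_Mapping.keys m) m" by (intro wt_keys[symmetric]) simp
  then show "wt {1..n} m = d"
    using assms by (simp add: homogeneous_component_def wt_def)
qed

lemma colon_witness_monomial:
  assumes hg: "hypergraph n Fs" and F: "F \<in> set Fs" and a: "a \<in> witness_monomials n Fs F t"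
  shows "colon (poly_ring n) (mon_span n (cover_monomials Fs t)) (Poly_Mapping.single a (1::'k::field))
    = var_ideal n F"
proof -
  have key: "Poly_Mapping.keys (g * Poly_Mapping.single a (1::'k)) = (\<lambda>m. m + a) ` Poly_Mapping.keys g"
    for g :: "'k mpoly"
  proof -
    have "Poly_Mapping.lookup (g * Poly_Mapping.single a (1::'k)) (m + a) = Poly_Mapping.lookup g m" for m
      by (simp add: lookup_times_single)
    moreover have "Poly_Mapping.keys (g * Poly_Mapping.single a (1::'k)) \<subseteq> (\<lambda>m. m + a) ` Poly_Mapping.keys g"
      using keys_mult[of g "Poly_Mapping.single a (1::'k)"] by auto
    ultimately show ?thesis by (auto simp: in_keys_iff)
  qed
  have "m + a \<in> cover_monomials Fs t \<longleftrightarrow> 1 \<le> wt F m" for m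
  proof
    assume "m + a \<in> cover_monomials Fs t"
    then show "1 \<le> wt F m" using a F by (auto simp: cover_monomials_def witness_monomials_def)
  next
    assume m: "1 \<le> wt F m"
    have "t \<le> wt G (m + a)" if "G \<in> set Fs" for G
    proof (cases "G = F")
      case True
      then show ?thesis using a m by (simp add: witness_monomials_def)
    next
      case False
      then have "t \<le> wt G a" using a that by (simp add: witness_monomials_def)
      then show ?thesis by simp
    qed
    then show "m + a \<in> cover_monomials Fs t" by (simp add: cover_monomials_def)
  qed
  then show ?thesis
    using a unfolding var_ideal_eq_mon_span[OF hypergraph_edge(2)[OF hg F]]
    by (auto simp: colon_def mon_span_def key in_poly_ring_iff keys_add_nat witness_monomials_def)
qed

text \<open>Since \<open>1\<close> does not multiply \<open>f\<close> into the power, some monomial \<open>a\<close> of \<open>f\<close> has \<open>wt\<close> below \<open>t\<close> on some edge,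
  while all variables of \<open>F\<close> do multiply \<open>a\<close> into the power. This edge therefore contains \<open>F\<close>, and so
  equals it.\<close>

lemma witness_monomial_of_colon:
  fixes f :: "'k::field mpoly"
  assumes hg: "hypergraph n Fs" and F: "F \<in> set Fs" and t: "t \<ge> 1"
    and f: "f \<in> carrier (poly_ring n)"
    and colon: "colon (poly_ring n) (mon_span n (cover_monomials Fs t)) f = var_ideal n F"
  obtains a where "a \<in> Poly_Mapping.keys f" "a \<in> witness_monomials n Fs F t"
proof -
  note FF = hypergraph_edge[OF hg F]
  have "(1::'k mpoly) \<notin> var_ideal n F"
    unfolding var_ideal_eq_mon_span[OF FF(2)] by (simp add: mon_span_def wt_def)
  then have "f \<notin> mon_span n (cover_monomials Fs t)"
    using colon by (auto simp: colon_def in_poly_ring_iff)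
  then obtain a G where a: "a \<in> Poly_Mapping.keys f" and G: "G \<in> set Fs" "wt G a < t"
    using f by (auto simp: mon_span_def in_poly_ring_iff cover_monomials_def not_le)
  have shift: "t \<le> wt G' (a + Poly_Mapping.single j 1)" if j: "j \<in> F" and G': "G' \<in> set Fs" for j G'
  proof -
    have "(var j :: 'k mpoly) * f \<in> mon_span n (cover_monomials Fs t)"
      using var_in_var_ideal[OF FF(2) j, where 'k='k] colon by (auto simp: colon_def)
    moreover have "Poly_Mapping.lookup ((var j :: 'k mpoly) * f) (Poly_Mapping.single j 1 + a) = Poly_Mapping.lookup f a"
      using lookup_times_single[of f "Poly_Mapping.single j 1" 1 a] by (simp add: var_def ac_simps)
    then have "Poly_Mapping.single j 1 + a \<in> Poly_Mapping.keys ((var j :: 'k mpoly) * f)"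
      using a by (simp add: in_keys_iff)
    ultimately show ?thesis
      using G' by (auto simp: mon_span_def cover_monomials_def add.commute)
  qed
  have fin: "finite G'" if "G' \<in> set Fs" for G' using hypergraph_edge(3)[OF hg that] .
  have "j \<in> G" if "j \<in> F" for j
    using shift[OF that G(1)] G fin[OF G(1)] by (auto split: if_splits)
  then have GF: "G = F" using hypergraph_antichain[OF hg F G(1)] by blast
  \<comment> \<open>One more variable of \<open>F\<close> suffices, so \<open>wt F a\<close> is exactly \<open>t - 1\<close>.\<close>
  obtain j where "j \<in> F" using FF(1) by blast
  then have "wt F a + 1 = t" using shift[OF _ F, of j] G GF FF(3) by simp
  moreover have "t \<le> wt G' a" if G': "G' \<in> set Fs" "G' \<noteq> F" for G'
  proof -
    obtain i where "i \<in> F" "i \<notin> G'" using hypergraph_antichain[OF hg F G'(1)] G'(2) by blast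
    then show ?thesis using shift[of i G'] G' fin[of G'] by simp
  qed
  ultimately have "a \<in> witness_monomials n Fs F t"
    using a f by (auto simp: witness_monomials_def in_poly_ring_iff)
  then show thesis using that a by blast
qed

lemma local_v_number_eq_Least:
  assumes hg: "hypergraph n Fs" and F: "F \<in> set Fs" and t: "t \<ge> 1"
  shows "local_v_number n (mon_span n (cover_monomials Fs t) :: 'k::field mpoly set) (var_ideal n F) =
    (LEAST d. \<exists>a\<in>witness_monomials n Fs F t. wt {1..n} a = d)"
proof -
  have "(\<exists>f\<in>homogeneous_component n d. colon (poly_ring n)
          (mon_span n (cover_monomials Fs t) :: 'k mpoly set) f = var_ideal n F) \<longleftrightarrow>
        (\<exists>a\<in>witness_monomials n Fs F t. wt {1..n} a = d)" for d
  proof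
    assume "\<exists>f\<in>homogeneous_component n d. colon (poly_ring n)
          (mon_span n (cover_monomials Fs t) :: 'k mpoly set) f = var_ideal n F"
    then obtain f :: "'k mpoly" where f: "f \<in> homogeneous_component n d"
      "colon (poly_ring n) (mon_span n (cover_monomials Fs t)) f = var_ideal n F" by blast
    then have "f \<in> carrier (poly_ring n)" by (simp add: homogeneous_component_def)
    then show "\<exists>a\<in>witness_monomials n Fs F t. wt {1..n} a = d"
      using witness_monomial_of_colon[OF hg F t _ f(2)] homogeneous_componentD(2)[OF f(1)] by metis
  next
    assume "\<exists>a\<in>witness_monomials n Fs F t. wt {1..n} a = d"
    then obtain a where a: "a \<in> witness_monomials n Fs F t" "wt {1..n} a = d" by blast
    then have keys: "Poly_Mapping.keys a \<subseteq> {1..n}" by (simp add: witness_monomials_def)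
    then have "wt (Poly_Mapping.keys a) a = d" using a(2) wt_keys[of "{1..n}" a] by simp
    then have "Poly_Mapping.single a (1::'k) \<in> homogeneous_component n d"
      using keys by (simp add: homogeneous_component_def in_poly_ring_iff wt_def)
    then show "\<exists>f\<in>homogeneous_component n d. colon (poly_ring n)
          (mon_span n (cover_monomials Fs t) :: 'k mpoly set) f = var_ideal n F"
      using colon_witness_monomial[OF hg F a(1)] by blast
  qed
  then show ?thesis by (simp add: local_v_number_def)
qed

section \<open>Linearity of the local v-numbers\<close>

text \<open>The exponent vector of the squarefree monomial with support \<open>V\<close>.\<close>

definition exponent_one_on :: "nat set \<Rightarrow> (nat \<Rightarrow>\<^sub>0 nat)" where
  "exponent_one_on V = (\<Sum>j\<in>V. Poly_Mapping.single j 1)"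

lemma lookup_exponent_one_on:
  "finite V \<Longrightarrow> Poly_Mapping.lookup (exponent_one_on V) j = (if j \<in> V then 1 else 0)"
  by (simp add: exponent_one_on_def lookup_sum lookup_single when_def)

lemma keys_exponent_one_on: "finite V \<Longrightarrow> Poly_Mapping.keys (exponent_one_on V) = V"
  by (auto simp: in_keys_iff lookup_exponent_one_on split: if_splits)

lemma wt_exponent_one_on:
  "finite V \<Longrightarrow> finite F \<Longrightarrow> wt F (exponent_one_on V) = card (F \<inter> V)"
  by (simp add: wt_def lookup_exponent_one_on sum.If_cases)

text \<open>The product of all variables outside \<open>F\<close> is a witness for the first power, because no other edge is
  contained in \<open>F\<close>.\<close>

lemma witness_monomials_nonempty:
  assumes hg: "hypergraph n Fs" and F: "F \<in> set Fs"
  obtains b where "b \<in> witness_monomials n Fs F 1" "wt {1..n} b \<le> n - 1"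
proof
  let ?V = "{1..n} - F" and ?b = "exponent_one_on ({1..n} - F)"
  note FF = hypergraph_edge[OF hg F]
  have "1 \<le> wt G ?b" if G: "G \<in> set Fs" "G \<noteq> F" for G
  proof -
    have "\<not> G \<subseteq> F" using hypergraph_antichain[OF hg G(1) F] G(2) by blast
    then have "G \<inter> ?V \<noteq> {}" using hypergraph_edge(2)[OF hg G(1)] by blast
    then have "1 \<le> card (G \<inter> ?V)" by (simp add: Suc_le_eq card_gt_0_iff)
    moreover have "wt G ?b = card (G \<inter> ?V)"
      by (rule wt_exponent_one_on) (use hypergraph_edge(3)[OF hg G(1)] in auto)
    ultimately show ?thesis by simp
  qed
  moreover have "wt F ?b = 0" using FF(3) by (simp add: wt_exponent_one_on)
  ultimately show "?b \<in> witness_monomials n Fs F 1"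
    by (simp add: witness_monomials_def keys_exponent_one_on del: One_nat_def)
  have "wt {1..n} ?b = card ?V" by (simp add: wt_exponent_one_on Int_absorb1 del: One_nat_def)
  also have "\<dots> = n - card F" using FF by (simp add: card_Diff_subset)
  also have "\<dots> \<le> n - 1" using FF by (simp add: Suc_le_eq card_gt_0_iff diff_le_mono2)
  finally show "wt {1..n} ?b \<le> n - 1" .
qed

text \<open>The monomials \<open>c\<close> with \<open>wt F c = 1\<close> and \<open>wt G c \<ge> 1\<close> for all edges \<open>G\<close>.\<close>

definition slope_monomials :: "nat \<Rightarrow> nat set list \<Rightarrow> nat set \<Rightarrow> (nat \<Rightarrow>\<^sub>0 nat) set" where
  "slope_monomials n Fs F = {c. Poly_Mapping.keys c \<subseteq> {1..n} \<and> wt F c = 1 \<and> (\<forall>G\<in>set Fs. 1 \<le> wt G c)}"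

lemma slope_monomials_nonempty:
  assumes hg: "hypergraph n Fs" and F: "F \<in> set Fs"
  obtains c where "c \<in> slope_monomials n Fs F"
proof -
  note FF = hypergraph_edge[OF hg F]
  obtain b where b: "b \<in> witness_monomials n Fs F 1" using witness_monomials_nonempty[OF hg F] .
  obtain j where j: "j \<in> F" using FF(1) by blast
  let ?c = "b + Poly_Mapping.single j 1"
  have F1: "wt F ?c = 1" using b j FF(3) by (simp add: witness_monomials_def)
  have "1 \<le> wt G ?c" if G: "G \<in> set Fs" for G
  proof (cases "G = F")
    case False
    then have "1 \<le> wt G b" using b G by (simp add: witness_monomials_def)
    then show ?thesis by simp
  qed (use F1 in simp)
  moreover have "Poly_Mapping.keys ?c \<subseteq> {1..n}"
    using b j FF(2) by (auto simp: witness_monomials_def keys_add_nat)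
  ultimately show thesis using that[of ?c] F1 by (simp add: slope_monomials_def)
qed

text \<open>For an edge \<open>F\<close> of a hypergraph, the local v-number of the cover ideal itself at the prime of \<open>F\<close>.\<close>

definition min_witness_degree :: "nat \<Rightarrow> nat set list \<Rightarrow> nat set \<Rightarrow> nat" where
  "min_witness_degree n Fs F = (LEAST d. \<exists>b\<in>witness_monomials n Fs F 1. wt {1..n} b = d)"

text \<open>For an edge \<open>F\<close> of a unimodular hypergraph, the increment of the local v-number at the prime of \<open>F\<close>
  from one power of the cover ideal to the next.\<close>

definition slope :: "nat \<Rightarrow> nat set list \<Rightarrow> nat set \<Rightarrow> nat" where
  "slope n Fs F = (LEAST d. \<exists>c\<in>slope_monomials n Fs F. wt {1..n} c = d)"

lemma Least_image_attained:
  fixes h :: "'a \<Rightarrow> nat"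
  assumes "x \<in> X"
  shows "\<exists>y\<in>X. h y = (LEAST d. \<exists>y\<in>X. h y = d)"
  using LeastI[of "\<lambda>d. \<exists>y\<in>X. h y = d" "h x"] assms by blast

lemma Least_image_le:
  fixes h :: "'a \<Rightarrow> nat"
  assumes "x \<in> X"
  shows "(LEAST d. \<exists>y\<in>X. h y = d) \<le> h x"
  using assms by (intro Least_le) blast

lemma slope_lower_bound:
  assumes H: "unimodular_hypergraph n Fs" and F: "F \<in> set Fs"
    and a: "Poly_Mapping.keys a \<subseteq> {1..n}" "wt F a = s" "\<And>G. G \<in> set Fs \<Longrightarrow> s \<le> wt G a"
  shows "s * slope n Fs F \<le> wt {1..n} a"
  using a
proof (induction s arbitrary: a)
  case (Suc s)
  obtain z r where zr: "a = z + r"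
    "\<And>G l. G \<in> set Fs \<Longrightarrow> Suc s * l \<le> wt G a \<Longrightarrow> l \<le> wt G z \<and> (Suc s - 1) * l \<le> wt G r"
    "\<And>G l. G \<in> set Fs \<Longrightarrow> wt G a \<le> Suc s * l \<Longrightarrow> wt G z \<le> l \<and> wt G r \<le> (Suc s - 1) * l"
    by (rule unimodular_split[OF H _ Suc.prems(1), of "Suc s"]) (simp, rule that)
  have lo: "1 \<le> wt G z" "s \<le> wt G r" if "G \<in> set Fs" for G
    using zr(2)[OF that, of 1] Suc.prems(3)[OF that] by simp_all
  have up: "wt F z \<le> 1" "wt F r \<le> s" using zr(3)[OF F, of 1] Suc.prems(2) by simp_all
  have keys: "Poly_Mapping.keys z \<subseteq> {1..n}" "Poly_Mapping.keys r \<subseteq> {1..n}"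
    using Suc.prems(1) by (simp_all add: zr(1) keys_add_nat)
  have "wt F z = 1" using up(1) lo(1)[OF F] by simp
  then have "z \<in> slope_monomials n Fs F" using keys lo by (simp add: slope_monomials_def)
  then have "slope n Fs F \<le> wt {1..n} z" unfolding slope_def by (rule Least_image_le)
  moreover have "s * slope n Fs F \<le> wt {1..n} r"
    using Suc.IH[OF keys(2) _ lo(2)] up(2) lo(2)[OF F] by simp
  ultimately show ?case by (simp add: zr(1))
qed simp

text \<open>The part \<open>z\<close> that is cut off \<open>a\<close> has \<open>wt F z \<le> 1\<close>. If \<open>wt F z = 1\<close>, it has at least the slope as its
  degree and the rest is a witness for the preceding power. If \<open>wt F z = 0\<close>, then \<open>z\<close> is a witness for
  the first power and the rest is bounded below by \<open>slope_lower_bound\<close>.\<close>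

lemma witness_lower_bound:
  assumes H: "unimodular_hypergraph n Fs" and F: "F \<in> set Fs"
    and a: "a \<in> witness_monomials n Fs F (Suc s)"
  shows "min_witness_degree n Fs F + s * slope n Fs F \<le> wt {1..n} a"
  using a
proof (induction s arbitrary: a)
  case 0
  then show ?case unfolding min_witness_degree_def using Least_image_le by fastforce
next
  case (Suc s)
  from Suc.prems have a: "Poly_Mapping.keys a \<subseteq> {1..n}" "wt F a = Suc s"
    "\<And>G. G \<in> set Fs \<Longrightarrow> G \<noteq> F \<Longrightarrow> Suc (Suc s) \<le> wt G a"
    by (auto simp: witness_monomials_def)
  obtain z r where zr: "a = z + r"
    "\<And>G l. G \<in> set Fs \<Longrightarrow> Suc (Suc s) * l \<le> wt G a \<Longrightarrow> l \<le> wt G z \<and> (Suc (Suc s) - 1) * l \<le> wt G r"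
    "\<And>G l. G \<in> set Fs \<Longrightarrow> wt G a \<le> Suc (Suc s) * l \<Longrightarrow> wt G z \<le> l \<and> wt G r \<le> (Suc (Suc s) - 1) * l"
    by (rule unimodular_split[OF H _ a(1), of "Suc (Suc s)"]) (simp, rule that)
  have lo: "1 \<le> wt G z" "Suc s \<le> wt G r" if "G \<in> set Fs" "G \<noteq> F" for G
    using zr(2)[OF that(1), of 1] a(3)[OF that] by simp_all
  have up: "wt F z \<le> 1" using zr(3)[OF F, of 1] a(2) by simp
  have sum: "wt F z + wt F r = Suc s" using a(2) by (simp add: zr(1))
  have keys: "Poly_Mapping.keys z \<subseteq> {1..n}" "Poly_Mapping.keys r \<subseteq> {1..n}"
    using a(1) by (simp_all add: zr(1) keys_add_nat)
  show ?case
  proof (cases "wt F z = 0")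
    case True
    then have "z \<in> witness_monomials n Fs F 1" using keys(1) lo(1) by (simp add: witness_monomials_def)
    then have "min_witness_degree n Fs F \<le> wt {1..n} z"
      unfolding min_witness_degree_def by (rule Least_image_le)
    moreover have "Suc s * slope n Fs F \<le> wt {1..n} r"
    proof (rule slope_lower_bound[OF H F keys(2)])
      show r: "wt F r = Suc s" using sum True by simp
      show "Suc s \<le> wt G r" if "G \<in> set Fs" for G
        using r lo(2)[OF that] by (cases "G = F") auto
    qed
    ultimately show ?thesis by (simp add: zr(1))
  next
    case False
    then have z1: "wt F z = 1" using up by simp
    then have "1 \<le> wt G z" if "G \<in> set Fs" for G using lo(1)[OF that] by (cases "G = F") auto
    then have "z \<in> slope_monomials n Fs F" using keys(1) z1 by (simp add: slope_monomials_def)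
    then have "slope n Fs F \<le> wt {1..n} z" unfolding slope_def by (rule Least_image_le)
    moreover have "r \<in> witness_monomials n Fs F (Suc s)"
      using keys(2) sum z1 lo(2) by (simp add: witness_monomials_def)
    note Suc.IH[OF this]
    ultimately show ?thesis by (simp add: zr(1))
  qed
qed

lemma witness_attained:
  assumes hg: "hypergraph n Fs" and F: "F \<in> set Fs"
  shows "\<exists>a\<in>witness_monomials n Fs F (Suc s).
    wt {1..n} a = min_witness_degree n Fs F + s * slope n Fs F"
proof (induction s)
  case 0
  obtain b where "b \<in> witness_monomials n Fs F 1" using witness_monomials_nonempty[OF hg F] .
  from Least_image_attained[OF this] show ?case by (simp add: min_witness_degree_def)
next
  case (Suc s)
  then obtain a where a: "a \<in> witness_monomials n Fs F (Suc s)"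
    "wt {1..n} a = min_witness_degree n Fs F + s * slope n Fs F" by blast
  obtain c0 where "c0 \<in> slope_monomials n Fs F" using slope_monomials_nonempty[OF hg F] .
  from Least_image_attained[OF this] obtain c where c: "c \<in> slope_monomials n Fs F"
    "wt {1..n} c = slope n Fs F" unfolding slope_def by blast
  have "Suc (Suc s) \<le> wt G (a + c)" if "G \<in> set Fs" "G \<noteq> F" for G
  proof -
    have "Suc s \<le> wt G a" "1 \<le> wt G c"
      using a(1) c(1) that by (auto simp: witness_monomials_def slope_monomials_def)
    then show ?thesis by simp
  qed
  then have "a + c \<in> witness_monomials n Fs F (Suc (Suc s))"
    using a(1) c(1) by (auto simp: witness_monomials_def slope_monomials_def keys_add_nat)
  then show ?case using a(2) c(2) by (intro bexI[of _ "a + c"]) auto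
qed

lemma local_v_number_linear:
  assumes H: "unimodular_hypergraph n Fs" and F: "F \<in> set Fs" and t: "t \<ge> 1"
  shows "local_v_number n (ideal_power n (cover_ideal n Fs :: 'k::field mpoly set) t) (var_ideal n F) =
    min_witness_degree n Fs F + (t - 1) * slope n Fs F"
proof -
  have hg: "hypergraph n Fs" using H by (simp add: unimodular_hypergraph_def)
  obtain s where s: "t = Suc s" using t by (cases t) auto
  show ?thesis
    unfolding ideal_power_cover_ideal[OF H] local_v_number_eq_Least[OF hg F t]
    using witness_attained[OF hg F, of s] witness_lower_bound[OF H F, of _ s]
    by (intro Least_equality) (auto simp: s)
qed

lemma min_witness_degree_le:
  assumes "hypergraph n Fs" "F \<in> set Fs"
  shows "min_witness_degree n Fs F \<le> n - 1"
proof -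
  obtain b where b: "b \<in> witness_monomials n Fs F 1" "wt {1..n} b \<le> n - 1"
    using witness_monomials_nonempty[OF assms] .
  have "min_witness_degree n Fs F \<le> wt {1..n} b"
    unfolding min_witness_degree_def using b(1) by (rule Least_image_le)
  then show ?thesis using b(2) by simp
qed

lemma min_witness_degree_pos:
  assumes hg: "hypergraph n Fs" and F: "F \<in> set Fs" and G: "G \<in> set Fs" "G \<noteq> F"
  shows "1 \<le> min_witness_degree n Fs F"
proof -
  obtain b where b: "b \<in> witness_monomials n Fs F (Suc 0)" "wt {1..n} b = min_witness_degree n Fs F"
    using witness_attained[OF hg F, of 0] by auto
  then have "1 \<le> wt G b" using G by (simp add: witness_monomials_def)
  also have "\<dots> \<le> wt {1..n} b" by (rule wt_mono) (use hypergraph_edge(2)[OF hg G(1)] in auto)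
  finally show ?thesis using b(2) by simp
qed

section \<open>Associated primes and v-numbers of the powers\<close>

lemma primeideal_power_notin:
  fixes x :: "'k::field mpoly"
  assumes P: "primeideal P (poly_ring n)" and x: "x \<in> carrier (poly_ring n)" "x \<notin> P"
  shows "x ^ s \<in> carrier (poly_ring n) \<and> x ^ s \<notin> P"
proof -
  interpret P: primeideal P "poly_ring n :: 'k mpoly ring" by (rule P)
  show ?thesis
  proof (induction s)
    case 0
    show ?case using P.one_imp_carrier P.I_notcarr P.one_closed by auto
  next
    case (Suc s)
    then show ?case using P.I_prime[of x "x ^ s"] P.m_closed[of x "x ^ s"] x by auto
  qed
qed

lemma primeideal_contains_INT:
  fixes P :: "'k::field mpoly set"
  assumes P: "primeideal P (poly_ring n)" and E: "finite E"
    and I: "\<And>i. i \<in> E \<Longrightarrow> ideal (I i) (poly_ring n)"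
    and sub: "carrier (poly_ring n) \<inter> (\<Inter>i\<in>E. I i) \<subseteq> P"
  obtains i where "i \<in> E" "I i \<subseteq> P"
proof (rule ccontr)
  interpret P: primeideal P "poly_ring n :: 'k mpoly ring" by (rule P)
  assume "\<not> thesis"
  then have "\<forall>i\<in>E. \<exists>x. x \<in> I i \<and> x \<notin> P" using that by blast
  then obtain x where x: "\<And>i. i \<in> E \<Longrightarrow> x i \<in> I i" "\<And>i. i \<in> E \<Longrightarrow> x i \<notin> P" by metis
  have carr: "x i \<in> carrier (poly_ring n)" if "i \<in> E" for i
    using ideal.Icarr[OF I[OF that] x(1)[OF that]] .
  have prod: "prod x A \<in> carrier (poly_ring n) \<and> prod x A \<notin> P" if "A \<subseteq> E" for A
    using finite_subset[OF that E] that
  proof (induction A)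
    case empty
    show ?case using P.one_imp_carrier P.I_notcarr P.one_closed by auto
  next
    case (insert i A)
    then show ?case
      using P.I_prime[of "x i" "prod x A"] P.m_closed[of "x i" "prod x A"] x(2)[of i] carr[of i] by auto
  qed
  have "prod x E \<in> I i" if i: "i \<in> E" for i
  proof -
    have "prod x E = x i * prod x (E - {i})" by (rule prod.remove[OF E i])
    then show ?thesis using ideal.I_r_closed[OF I[OF i] x(1)[OF i], of "prod x (E - {i})"] prod[of "E - {i}"]
      by auto
  qed
  then show False using sub prod[of E] by blast
qed

text \<open>A prime of the form \<open>J\<^sup>t : f\<close> is an intersection of the ideals \<open>Q F : f\<close> with \<open>Q F\<close> spanned by the
  monomials with \<open>wt F\<close> at least \<open>t\<close>, hence one of them. As \<open>Q F\<close> is primary to the prime of \<open>F\<close>, the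
  colon is that prime.\<close>

lemma associated_primes_cover_power:
  assumes H: "unimodular_hypergraph n Fs" and t: "t \<ge> 1"
  shows "associated_primes (poly_ring n) (ideal_power n (cover_ideal n Fs) t) =
    (var_ideal n ` set Fs :: 'k::field mpoly set set)"
proof
  have hg: "hypergraph n Fs" using H by (simp add: unimodular_hypergraph_def)
  interpret R: cring "poly_ring n :: 'k mpoly ring" by (rule cring_poly_ring)
  show "var_ideal n ` set Fs \<subseteq> associated_primes (poly_ring n)
      (ideal_power n (cover_ideal n Fs) t :: 'k mpoly set)"
  proof
    fix P :: "'k mpoly set" assume "P \<in> var_ideal n ` set Fs"
    then obtain F where F: "F \<in> set Fs" "P = var_ideal n F" by blast
    obtain s where s: "t = Suc s" using t by (cases t) auto
    obtain a where a: "a \<in> witness_monomials n Fs F t" using witness_attained[OF hg F(1), of s] s by blast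
    then have "Poly_Mapping.single a (1::'k) \<in> carrier (poly_ring n)"
      by (simp add: witness_monomials_def in_poly_ring_iff)
    then show "P \<in> associated_primes (poly_ring n) (ideal_power n (cover_ideal n Fs) t)"
      using colon_witness_monomial[OF hg F(1) a, where 'k='k] F(2)
        primeideal_var_ideal[OF hypergraph_edge(2)[OF hg F(1)], where 'k='k]
      unfolding associated_primes_def ideal_power_cover_ideal[OF H] by blast
  qed
  show "associated_primes (poly_ring n) (ideal_power n (cover_ideal n Fs) t) \<subseteq>
      (var_ideal n ` set Fs :: 'k mpoly set set)"
  proof
    fix P :: "'k mpoly set"
    assume "P \<in> associated_primes (poly_ring n) (ideal_power n (cover_ideal n Fs) t)"
    then obtain f where P: "primeideal P (poly_ring n)" and f: "f \<in> carrier (poly_ring n)"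
      and colon: "colon (poly_ring n) (mon_span n (cover_monomials Fs t)) f = P"
      unfolding associated_primes_def ideal_power_cover_ideal[OF H] by blast
    interpret P: primeideal P "poly_ring n :: 'k mpoly ring" by (rule P)
    define Q where "Q F = (mon_span n {m. t \<le> wt F m} :: 'k mpoly set)" for F
    have Q_ideal: "ideal (Q F) (poly_ring n)" for F
      unfolding Q_def by (rule mon_span_ideal) simp
    have colon_ideal: "ideal (colon (poly_ring n) (Q F) f) (poly_ring n)" for F
    proof (rule idealI)
      show "ring (poly_ring n :: 'k mpoly ring)" by (rule R.ring_axioms)
      show "subgroup (colon (poly_ring n) (Q F) f) (add_monoid (poly_ring n :: 'k mpoly ring))"
      proof
        fix p :: "'k mpoly" assume p: "p \<in> colon (poly_ring n) (Q F) f"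
        then have "- p * f \<in> Q F" by (simp add: colon_def Q_def mon_span_def)
        moreover have "- p \<in> carrier (poly_ring n)" using p by (simp add: colon_def in_poly_ring_iff)
        ultimately show "inv\<^bsub>add_monoid (poly_ring n)\<^esub> p \<in> colon (poly_ring n) (Q F) f"
          using a_inv_poly_ring[of p n] p by (simp add: a_inv_def colon_def)
      next
        fix p q :: "'k mpoly" assume "p \<in> colon (poly_ring n) (Q F) f" "q \<in> colon (poly_ring n) (Q F) f"
        then show "p \<otimes>\<^bsub>add_monoid (poly_ring n)\<^esub> q \<in> colon (poly_ring n) (Q F) f"
          using R.a_closed[of p q] by (simp add: colon_def Q_def distrib_right mon_span_add)
      qed (auto simp: colon_def Q_def mon_span_def in_poly_ring_iff)
      fix a x :: "'k mpoly" assume *: "a \<in> colon (poly_ring n) (Q F) f" "x \<in> carrier (poly_ring n)"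
      then have "x * (a * f) \<in> Q F" using ideal.I_l_closed[OF Q_ideal, of "a * f" F x]
        by (simp add: colon_def)
      then show "x \<otimes>\<^bsub>poly_ring n\<^esub> a \<in> colon (poly_ring n) (Q F) f"
        "a \<otimes>\<^bsub>poly_ring n\<^esub> x \<in> colon (poly_ring n) (Q F) f"
        using * R.m_closed[of x a] by (simp_all add: colon_def ac_simps)
    qed
    have mem: "p \<in> mon_span n (cover_monomials Fs t) \<longleftrightarrow> (\<forall>F\<in>set Fs. p \<in> Q F)"
      if "p \<in> carrier (poly_ring n)" for p :: "'k mpoly"
      using that unfolding Q_def mon_span_def cover_monomials_def in_poly_ring_iff by blast
    have "carrier (poly_ring n) \<inter> (\<Inter>F\<in>set Fs. colon (poly_ring n) (Q F) f) \<subseteq> P"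
      unfolding colon[symmetric] using mem R.m_closed[OF _ f] by (auto simp: colon_def)
    then obtain F where F: "F \<in> set Fs" "colon (poly_ring n) (Q F) f \<subseteq> P"
      using primeideal_contains_INT[where I = "\<lambda>F. colon (poly_ring n) (Q F) f", OF P finite_set colon_ideal]
      by blast
    note FF = hypergraph_edge[OF hg F(1)]
    have P_sub: "p * f \<in> Q F" if "p \<in> P" for p
      using that F(1) mem R.m_closed[OF _ f, of p] unfolding colon[symmetric] by (auto simp: colon_def)
    have "1 \<notin> P" using P.one_imp_carrier P.I_notcarr by auto
    then have "1 \<notin> colon (poly_ring n) (Q F) f" using F(2) by blast
    then have "f \<notin> Q F" using R.one_closed by (simp add: colon_def)
    then obtain a where a: "a \<in> Poly_Mapping.keys f" "wt F a < t"
      using f by (auto simp: Q_def mon_span_def in_poly_ring_iff not_le)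
    have "P \<subseteq> var_ideal n F"
    proof
      fix g assume g: "g \<in> P"
      show "g \<in> var_ideal n F"
      proof (rule ccontr)
        assume "g \<notin> var_ideal n F"
        then obtain b where "b \<in> Poly_Mapping.keys g" "wt F b = 0"
          using P.Icarr[OF g] by (auto simp: var_ideal_eq_mon_span[OF FF(2)] mon_span_def in_poly_ring_iff)
        then obtain m where "m \<in> Poly_Mapping.keys (g * f)" "wt F m < t"
          using lowest_wt_mult[OF a] by metis
        then show False using P_sub[OF g] by (auto simp: Q_def mon_span_def)
      qed
    qed
    moreover have "var_ideal n F \<subseteq> P"
      unfolding var_ideal_def
    proof (rule R.genideal_minimal)
      show "ideal P (poly_ring n)" by (rule P.is_ideal)
      show "(var ` F :: 'k mpoly set) \<subseteq> P"
      proof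
        fix x :: "'k mpoly" assume "x \<in> var ` F"
        then obtain j where j: "j \<in> F" "x = var j" by blast
        have x: "x \<in> carrier (poly_ring n)"
          using j FF(2) by (auto simp: var_def in_poly_ring_iff)
        have "x ^ s * f \<in> mon_span n {m. s \<le> wt F m}" for s
        proof (induction s)
          case 0
          then show ?case using f mon_span_UNIV by auto
        next
          case (Suc s)
          have "x \<in> mon_span n {m. 1 \<le> wt F m}"
            using var_in_var_ideal[OF FF(2) j(1), where 'k='k] j(2) var_ideal_eq_mon_span[OF FF(2)] by blast
          from mon_span_mult[OF this Suc, of "{m. Suc s \<le> wt F m}"] show ?case
            by (simp add: mult.assoc)
        qed
        then have "x ^ t * f \<in> Q F" by (simp add: Q_def)
        moreover have "x ^ t \<in> carrier (poly_ring n)"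
        proof (induction t)
          case (Suc t)
          then show ?case using R.m_closed[OF x] by simp
        qed (use R.one_closed in simp)
        ultimately have "x ^ t \<in> P" using F(2) by (auto simp: colon_def)
        then show "x \<in> P" using primeideal_power_notin[OF P x] by blast
      qed
    qed
    ultimately show "P \<in> var_ideal n ` set Fs" using F(1) by blast
  qed
qed

theorem theorem1p1:
  fixes n :: nat and Fs :: "nat set list" and J :: "'k::field mpoly set"
  assumes "unimodular_hypergraph n Fs"
    and "J = cover_ideal n Fs"
  shows "(\<forall>F\<in>set Fs. \<exists>\<gamma>::int. \<forall>t::nat. t \<ge> 1 \<longrightarrow>
            int (local_v_number n (ideal_power n J t) (var_ideal n F)) =
              int (local_v_number n J (var_ideal n F)) + (int t - 1) * \<gamma>) \<and>
         (\<exists>a b::int. \<forall>t::nat. t \<ge> 1 \<and> int t \<ge> int n - 1 \<longrightarrow>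
            int (v_number n (ideal_power n J t)) = a * int t + b)"
proof
  note H = assms(1)
  have hg: "hypergraph n Fs" using H by (simp add: unimodular_hypergraph_def)
  let ?\<alpha> = "min_witness_degree n Fs" and ?\<gamma> = "slope n Fs"
  have local: "local_v_number n (ideal_power n J t) (var_ideal n F) = ?\<alpha> F + (t - 1) * ?\<gamma> F"
    if "F \<in> set Fs" "t \<ge> 1" for F t
    using local_v_number_linear[OF H that, where 'k='k] by (simp add: assms(2))
  have "ideal_power n J 1 = J"
    using ideal_power_cover_ideal[OF H, of 1, where 'k='k] cover_ideal_eq_mon_span[OF hg, where 'k='k]
    by (simp add: assms(2))
  then have local1: "local_v_number n J (var_ideal n F) = ?\<alpha> F" if "F \<in> set Fs" for F
    using local[OF that, of 1] by simp
  show "\<forall>F\<in>set Fs. \<exists>\<gamma>::int. \<forall>t::nat. t \<ge> 1 \<longrightarrow>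
      int (local_v_number n (ideal_power n J t) (var_ideal n F)) =
        int (local_v_number n J (var_ideal n F)) + (int t - 1) * \<gamma>"
  proof
    fix F assume F: "F \<in> set Fs"
    show "\<exists>\<gamma>::int. \<forall>t::nat. t \<ge> 1 \<longrightarrow>
      int (local_v_number n (ideal_power n J t) (var_ideal n F)) =
        int (local_v_number n J (var_ideal n F)) + (int t - 1) * \<gamma>"
      by (rule exI[of _ "int (?\<gamma> F)"]) (simp add: local[OF F] local1[OF F] of_nat_diff)
  qed
  \<comment> \<open>As \<open>?\<alpha>\<close> takes values below \<open>n\<close>, this is the lexicographic minimum of slope and intercept.\<close>
  have "set Fs \<noteq> {}" using hg by (simp add: hypergraph_def)
  then obtain F where F: "F \<in> set Fs"
    and min: "\<And>G. G \<in> set Fs \<Longrightarrow> ?\<gamma> F * n + ?\<alpha> F \<le> ?\<gamma> G * n + ?\<alpha> G"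
    using ex_is_arg_min_if_finite[of "set Fs" "\<lambda>F. ?\<gamma> F * n + ?\<alpha> F"]
    by (auto simp: is_arg_min_linorder)
  have "n \<ge> 1" using hypergraph_edge(1,2)[OF hg F] by (cases n) auto
  have v: "v_number n (ideal_power n J t) = ?\<alpha> F + (t - 1) * ?\<gamma> F"
    if t: "t \<ge> 1" "int t \<ge> int n - 1" for t
  proof -
    have le: "?\<alpha> F + (t - 1) * ?\<gamma> F \<le> ?\<alpha> G + (t - 1) * ?\<gamma> G" if G: "G \<in> set Fs" for G
    proof (cases "?\<gamma> G \<le> ?\<gamma> F")
      case True
      have "?\<gamma> G = ?\<gamma> F"
      proof (rule ccontr)
        assume "?\<gamma> G \<noteq> ?\<gamma> F"
        then have "Suc (?\<gamma> G) * n \<le> ?\<gamma> F * n" using True by (intro mult_right_mono) auto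
        then have "n \<le> ?\<alpha> G" using min[OF G] by simp
        then show False using min_witness_degree_le[OF hg G] \<open>n \<ge> 1\<close> by simp
      qed
      then show ?thesis using min[OF G] by simp
    next
      case False
      then have "F \<noteq> G" by auto
      then have "?\<alpha> F \<le> ?\<alpha> G + (t - 1)"
        using min_witness_degree_le[OF hg F] min_witness_degree_pos[OF hg G F] t by linarith
      moreover have "(t - 1) * Suc (?\<gamma> F) \<le> (t - 1) * ?\<gamma> G" using False by (intro mult_left_mono) auto
      ultimately show ?thesis by simp
    qed
    have "v_number n (ideal_power n J t) = (INF G\<in>set Fs. ?\<alpha> G + (t - 1) * ?\<gamma> G)"
      unfolding v_number_def assms(2) associated_primes_cover_power[OF H t(1)] image_image
      using local[OF _ t(1)] by (intro INF_cong refl) (simp add: assms(2))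
    also have "\<dots> = ?\<alpha> F + (t - 1) * ?\<gamma> F"
      using F le by (intro cInf_eq_minimum) auto
    finally show ?thesis .
  qed
  show "\<exists>a b::int. \<forall>t::nat. t \<ge> 1 \<and> int t \<ge> int n - 1 \<longrightarrow>
      int (v_number n (ideal_power n J t)) = a * int t + b"
  proof (intro exI allI impI, elim conjE)
    fix t :: nat assume t: "t \<ge> 1" "int t \<ge> int n - 1"
    have "int (v_number n (ideal_power n J t)) = int (?\<alpha> F) + (int t - 1) * int (?\<gamma> F)"
      using t(1) by (simp add: v[OF t] of_nat_diff)
    then show "int (v_number n (ideal_power n J t)) =
        int (?\<gamma> F) * int t + (int (?\<alpha> F) - int (?\<gamma> F))"
      by (simp add: algebra_simps)
  qed
qed

end
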